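(* Let $1\le r_1,r_2\le n$ and $1\le s_1\le s_2$, and put $\mathbf r=\min\{r_1,r_2\}$, $\mathbf{\tilde r}=\max\{r_1,r_2\}$. Let $A\otimes B\in B^{r_1,s_1}\otimes B^{r_2,s_2}$ with $A=(a_{p,q})$, and let $H$ be the local energy function on $B^{r_1,s_1}\otimes B^{r_2,s_2}$ normalized by $H(0\otimes0)=0$. For $0\le s\le n-r_2$ and $0\le r\le r_2+s$ define elements $A^s_r\in B^{r_1,s_1}$, $B^s_r\in B^{r_2,s_2}$ recursively by: for $s=0$: $A^0_0=A$, $B^0_0=B$, and for $1\le r\le r_2$ $$A^0_r=\tilde e_r^{(\epsilon_r(A^0_{r-1})-\varphi_r(B^0_{r-1}))_+}A^0_{r-1},\qquad B^0_r=\tilde e_r^{\epsilon_r(B^0_{r-1})}B^0_{r-1};$$ for $s>0$: $A^s_0=A^{s-1}_{r_2+s-1}$, $B^s_0=B^{s-1}_{r_2+s-1}$, and for $1\le r\le r_2+s$ $$A^s_r=\tilde e_{t}^{(\epsilon_{t}(A^s_{r-1})-\varphi_{t}(B^s_{r-1}))_+}A^s_{r-1},\qquad B^s_r=\tilde e_{t}^{\epsilon_{t}(B^s_{r-1})}B^s_{r-1},$$ where $t=r$ if $1\le r\le r_2-1$ and $t=2r_2+s-r$ if $r_2\le r\le r_2+s$. Here $x_+=x$ if $x>0$ and $x_+=0$ otherwise. Then $$H(A\otimes B)=-\sum_{\substack{1\le p\le\mathbf r\\ \mathbf{\tilde r}\le q\le n}}a_{p,q}+\sum_{s=0}^{n-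r_2}\bigl(\epsilon_{r_2}(A^s_{r_2+s-1})-\varphi_{r_2}(B^s_{r_2+s-1})\bigr)_+.$$
   Context: Let $n\ge 1$, $I=\{0,1,\dots,n\}$, $I_0=\{1,\dots,n\}$ (affine type $A_n^{(1)}$); let $\alpha_l,\omega_l$ ($l\in I_0$) be the simple roots and fundamental weights of type $A_n$ and $\alpha_{p,q}=\alpha_p+\alpha_{p+1}+\cdots+\alpha_q$ for $1\le p\le q\le n$. The crystal $B^{i,m}$ ($1\le i\le n$, $m\ge1$). It is the set of arrays $A=(a_{p,q})_{1\le p\le i,\ i\le q\le n}$ of non-negative integers ($p$ is the column index, $q$ the row index) such that $\sum_{s=1}^n a_{\beta(s)}\le m$ for every sequence $(\beta(1),\dots,\beta(n))$ with $\beta(1)=(1,i)$, $\beta(n)=(i,n)$ and such that $\beta(s)=(p,q)$ implies $\beta(s+1)\in\{(p,q+1),(p+1,q)\}$. The weight is $\mathrm{wt}(A)=m\omega_i-\sum_{1\le p\le i\le q\le n}a_{p,q}\alpha_{p,q}$. The array with all entries zero is denoted $0$ (not to be confused with the symbol $0$ used when a Kashiwara operator annihilates an element). For $l>i$ let $F_l(p)=\sum_{j=1}^p a_{j,l-1}+\sum_{j=p}^i a_{j,l}$ ($1\le p\le i$), and let $p^l_+(A)$ (resp. $q^l_+(A)$) be the smallest (resp. largest) $p$ at which $F_l$ attains its maximum. For $1\le l<i$ let $G_l(p)=\sum_{j=i}^p a_{l,j}+\sum_{j=p}^n a_{l+1,j}$ ($i\le p\le n$), and let $p^l_-(A)$ (resp.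 $q^l_-(A)$) be the largest (resp. smallest) $p$ at which $G_l$ attains its maximum. Set $\varphi_i(A)=m-\sum_{j=1}^{i-1}a_{j,i}-\sum_{j=i}^n a_{i,j}$; $\varphi_l(A)=\sum_{j=1}^{p^l_+(A)}a_{j,l-1}-\sum_{j=1}^{p^l_+(A)-1}a_{j,l}$ for $l>i$; $\varphi_l(A)=\sum_{j=p^l_-(A)}^n a_{l+1,j}-\sum_{j=p^l_-(A)+1}^n a_{l,j}$ for $1\le l<i$; $\varphi_0(A)=a_{1,n}$; $\epsilon_i(A)=a_{i,i}$; $\epsilon_l(A)=\sum_{j=q^l_+(A)}^i a_{j,l}-\sum_{j=q^l_+(A)+1}^i a_{j,l-1}$ for $l>i$; $\epsilon_l(A)=\sum_{j=i}^{q^l_-(A)}a_{l,j}-\sum_{j=i}^{q^l_-(A)-1}a_{l+1,j}$ for $1\le l<i$; $\epsilon_0(A)=m-\sum_{j=i}^n a_{1,j}-\sum_{j=2}^i a_{j,n}$. For $l\in I$, $\tilde f_lA=0$ if $\varphi_l(A)=0$, and otherwise $\tilde f_l$ acts by: $l=0$: $a_{1,n}\mapsto a_{1,n}-1$; $l=i$: $a_{i,i}\mapsto a_{i,i}+1$; $l>i$: with $p=p^l_+(A)$, $a_{p,l-1}\mapsto a_{p,l-1}-1$ and $a_{p,l}\mapsto a_{p,l}+1$; $1\le l<i$: with $p=p^l_-(A)$, $a_{l,p}\mapsto a_{l,p}+1$ and $a_{l+1,p}\mapsto a_{l+1,p}-1$. Likewise $\tilde e_lA=0$ if $\epsilon_l(A)=0$,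 and otherwise: $l=0$: $a_{1,n}\mapsto a_{1,n}+1$; $l=i$: $a_{i,i}\mapsto a_{i,i}-1$; $l>i$: with $q=q^l_+(A)$, $a_{q,l-1}\mapsto a_{q,l-1}+1$ and $a_{q,l}\mapsto a_{q,l}-1$; $1\le l<i$: with $q=q^l_-(A)$, $a_{l,q}\mapsto a_{l,q}-1$ and $a_{l+1,q}\mapsto a_{l+1,q}+1$. With this structure $B^{i,m}$ is a realization of the Kirillov--Reshetikhin crystal. Tensor products. $B_1\otimes B_2$ is the set $B_1\times B_2$ with: $\tilde f_l(b_1\otimes b_2)=(\tilde f_lb_1)\otimes b_2$ if $\epsilon_l(b_1)\ge\varphi_l(b_2)$ and $b_1\otimes(\tilde f_lb_2)$ otherwise; $\tilde e_l(b_1\otimes b_2)=(\tilde e_lb_1)\otimes b_2$ if $\epsilon_l(b_1)>\varphi_l(b_2)$ and $b_1\otimes(\tilde e_lb_2)$ otherwise; $\mathrm{wt}(b_1\otimes b_2)=\mathrm{wt}(b_1)+\mathrm{wt}(b_2)$; $\varphi_l(b_1\otimes b_2)=\max\{\varphi_l(b_1),\varphi_l(b_1)+\varphi_l(b_2)-\epsilon_l(b_1)\}$; $\epsilon_l(b_1\otimes b_2)=\max\{\epsilon_l(b_2),\epsilon_l(b_1)+\epsilon_l(b_2)-\varphi_l(b_2)\}$. The combinatorial $R$-matrix $\sigma:B^{r_1,s_1}\otimes B^{r_2,s_2}\to B^{r_2,s_2}\otimes B^{r_1,s_1}$ is the unique isomorphism of affine crystals (bijection preserving $\mathrm{wt},\epsilon_l,\varphi_l$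 and commuting with $\tilde e_l,\tilde f_l$ for all $l\in I$); it is known to exist and it satisfies $\sigma(0\otimes0)=0\otimes0$. The local energy function. There is a function $H:B^{r_1,s_1}\otimes B^{r_2,s_2}\to\mathbb Z$, unique up to an additive constant, such that whenever $\tilde e_l(b_1\otimes b_2)\ne0$ ($l\in I$), $H(\tilde e_l(b_1\otimes b_2))=H(b_1\otimes b_2)+\delta$, where $\delta=-1$ if $l=0$ and $\tilde e_0$ acts on the first tensor factor of both $b_1\otimes b_2$ and $\sigma(b_1\otimes b_2)$, $\delta=1$ if $l=0$ and $\tilde e_0$ acts on the second tensor factor of both, and $\delta=0$ otherwise. It is normalized by $H(0\otimes0)=0$. *)

theory Defs
  imports Main
begin

section \<open>Affine crystals of type \<open>A\<^sub>n\<^sup>(\<^sup>1\<^sup>)\<close>\<close>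

text \<open>
  A classical weight of type \<open>A\<^sub>n\<close> is represented by its coordinates with respect to the
  fundamental weights \<open>\<omega>\<^sub>1, \<dots>, \<omega>\<^sub>n\<close>; the coordinates outside \<open>{1..n}\<close> are \<open>0\<close>.
\<close>

type_synonym weight = "nat \<Rightarrow> int"

definition fund_weight :: "nat \<Rightarrow> weight" where
  "fund_weight i = (\<lambda>k. if k = i then 1 else 0)"

text \<open>The simple root \<open>\<alpha>\<^sub>l = 2\<omega>\<^sub>l - \<omega>\<^sub>l\<^sub>-\<^sub>1 - \<omega>\<^sub>l\<^sub>+\<^sub>1\<close>, where \<open>\<omega>\<^sub>0 = \<omega>\<^sub>n\<^sub>+\<^sub>1 = 0\<close>.\<close>

definition simple_root :: "nat \<Rightarrow> nat \<Rightarrow> weight" where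
  "simple_root n l = (\<lambda>k.
     if k \<notin> {1..n} then 0
     else if k = l then 2
     else if k = l + 1 \<or> l = k + 1 then -1
     else 0)"

definition pos_root :: "nat \<Rightarrow> nat \<Rightarrow> nat \<Rightarrow> weight" where
  "pos_root n p q = (\<lambda>k. \<Sum>l=p..q. simple_root n l k)"

text \<open>
  The value \<open>None\<close> of a Kashiwara operator is the extra element \<open>0\<close>. Only indices
  \<open>l \<in> {0..n}\<close> and elements of \<open>elems\<close> are meaningful arguments.
\<close>

record 'b crystal =
  elems :: "'b set"
  wt :: "'b \<Rightarrow> weight"
  eps :: "nat \<Rightarrow> 'b \<Rightarrow> int"
  phi :: "nat \<Rightarrow> 'b \<Rightarrow> int"
  etil :: "nat \<Rightarrow> 'b \<Rightarrow> 'b option"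
  ftil :: "nat \<Rightarrow> 'b \<Rightarrow> 'b option"

definition tensor :: "'a crystal \<Rightarrow> 'b crystal \<Rightarrow> ('a \<times> 'b) crystal" where
  "tensor B1 B2 = \<lparr>
     elems = elems B1 \<times> elems B2,
     wt = (\<lambda>(b1, b2). (\<lambda>k. wt B1 b1 k + wt B2 b2 k)),
     eps = (\<lambda>l (b1, b2). max (eps B2 l b2) (eps B1 l b1 + eps B2 l b2 - phi B2 l b2)),
     phi = (\<lambda>l (b1, b2). max (phi B1 l b1) (phi B1 l b1 + phi B2 l b2 - eps B1 l b1)),
     etil = (\<lambda>l (b1, b2).
       if eps B1 l b1 > phi B2 l b2
       then map_option (\<lambda>c. (c, b2)) (etil B1 l b1)
       else map_option (\<lambda>c. (b1, c)) (etil B2 l b2)),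
     ftil = (\<lambda>l (b1, b2).
       if eps B1 l b1 \<ge> phi B2 l b2
       then map_option (\<lambda>c. (c, b2)) (ftil B1 l b1)
       else map_option (\<lambda>c. (b1, c)) (ftil B2 l b2)) \<rparr>"

definition crystal_iso :: "nat \<Rightarrow> 'a crystal \<Rightarrow> 'b crystal \<Rightarrow> ('a \<Rightarrow> 'b) \<Rightarrow> bool" where
  "crystal_iso n B C \<sigma> \<longleftrightarrow>
     bij_betw \<sigma> (elems B) (elems C) \<and>
     (\<forall>b\<in>elems B. wt C (\<sigma> b) = wt B b) \<and>
     (\<forall>b\<in>elems B. \<forall>l\<in>{0..n}.
        eps C l (\<sigma> b) = eps B l b \<and>
        phi C l (\<sigma> b) = phi B l b \<and>
        etil C l (\<sigma> b) = map_option \<sigma> (etil B l b) \<and>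
        ftil C l (\<sigma> b) = map_option \<sigma> (ftil B l b))"

definition combinatorial_R ::
  "nat \<Rightarrow> 'a crystal \<Rightarrow> 'b crystal \<Rightarrow> ('a \<times> 'b \<Rightarrow> 'b \<times> 'a) \<Rightarrow> bool" where
  "combinatorial_R n B1 B2 \<sigma> \<longleftrightarrow> crystal_iso n (tensor B1 B2) (tensor B2 B1) \<sigma>"

text \<open>For an element with nonzero image, the factor of the tensor product on which
  \<open>etil (tensor B1 B2) l\<close> acts.\<close>

definition etil_on_first :: "'a crystal \<Rightarrow> 'b crystal \<Rightarrow> nat \<Rightarrow> 'a \<times> 'b \<Rightarrow> bool" where
  "etil_on_first B1 B2 l b \<longleftrightarrow> eps B1 l (fst b) > phi B2 l (snd b)"

definition local_energy ::
  "nat \<Rightarrow> 'a crystal \<Rightarrow> 'b crystal \<Rightarrow> ('a \<times> 'b \<Rightarrow> 'b \<times> 'a) \<Rightarrow> ('a \<times> 'b \<Rightarrow> int) \<Rightarrow> bool" where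
  "local_energy n B1 B2 \<sigma> H \<longleftrightarrow>
     (\<forall>b\<in>elems (tensor B1 B2). \<forall>l\<in>{0..n}. \<forall>b'.
        etil (tensor B1 B2) l b = Some b' \<longrightarrow>
        H b' = H b +
          (if l = 0 \<and> etil_on_first B1 B2 0 b \<and> etil_on_first B2 B1 0 (\<sigma> b) then -1
           else if l = 0 \<and> \<not> etil_on_first B1 B2 0 b \<and> \<not> etil_on_first B2 B1 0 (\<sigma> b) then 1
           else 0))"

text \<open>
  The \<open>k\<close>-fold application of \<open>etil B l\<close>. It is a genuine element as long as
  \<open>k \<le> eps B l b\<close>, which holds at every use below; otherwise the value is unspecified.
\<close>

definition etil_pow :: "'b crystal \<Rightarrow> nat \<Rightarrow> nat \<Rightarrow> 'b \<Rightarrow> 'b" where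
  "etil_pow B l k b = the (((\<lambda>x. Option.bind x (etil B l)) ^^ k) (Some b))"


section \<open>The Kirillov--Reshetikhin crystal \<open>B\<^sup>i\<^sup>,\<^sup>m\<close>\<close>

text \<open>
  An array is a function \<open>A\<close> with \<open>A p q\<close> the entry in column \<open>p\<close> and row \<open>q\<close>. To make equality
  of arrays equality of functions, entries outside \<open>{1..i} \<times> {i..n}\<close> are required to be \<open>0\<close>.
\<close>

type_synonym arr = "nat \<Rightarrow> nat \<Rightarrow> nat"

definition zero_arr :: arr where
  "zero_arr = (\<lambda>p q. 0)"

definition KR_path :: "nat \<Rightarrow> nat \<Rightarrow> (nat \<Rightarrow> nat \<times> nat) \<Rightarrow> bool" where
  "KR_path n i \<beta> \<longleftrightarrow> \<beta> 1 = (1, i) \<and> \<beta> n = (i, n) \<and>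
     (\<forall>s\<in>{1..<n}. \<forall>p q. \<beta> s = (p, q) \<longrightarrow> \<beta> (s + 1) \<in> {(p, q + 1), (p + 1, q)})"

definition KR_elems :: "nat \<Rightarrow> nat \<Rightarrow> nat \<Rightarrow> arr set" where
  "KR_elems n i m = {A.
     (\<forall>p q. \<not> (p \<in> {1..i} \<and> q \<in> {i..n}) \<longrightarrow> A p q = 0) \<and>
     (\<forall>\<beta>. KR_path n i \<beta> \<longrightarrow> (\<Sum>s=1..n. A (fst (\<beta> s)) (snd (\<beta> s))) \<le> m)}"

definition KR_wt :: "nat \<Rightarrow> nat \<Rightarrow> nat \<Rightarrow> arr \<Rightarrow> weight" where
  "KR_wt n i m A = (\<lambda>k.
     int m * fund_weight i k - (\<Sum>p=1..i. \<Sum>q=i..n. int (A p q) * pos_root n p q k))"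

definition maximizers :: "nat set \<Rightarrow> (nat \<Rightarrow> nat) \<Rightarrow> nat set" where
  "maximizers S g = {p\<in>S. \<forall>p'\<in>S. g p' \<le> g p}"

definition KR_F :: "nat \<Rightarrow> arr \<Rightarrow> nat \<Rightarrow> nat \<Rightarrow> nat" where
  "KR_F i A l p = (\<Sum>j=1..p. A j (l - 1)) + (\<Sum>j=p..i. A j l)"

definition KR_G :: "nat \<Rightarrow> nat \<Rightarrow> arr \<Rightarrow> nat \<Rightarrow> nat \<Rightarrow> nat" where
  "KR_G n i A l p = (\<Sum>j=i..p. A l j) + (\<Sum>j=p..n. A (l + 1) j)"

definition p_plus :: "nat \<Rightarrow> arr \<Rightarrow> nat \<Rightarrow> nat" where
  "p_plus i A l = Min (maximizers {1..i} (KR_F i A l))"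

definition q_plus :: "nat \<Rightarrow> arr \<Rightarrow> nat \<Rightarrow> nat" where
  "q_plus i A l = Max (maximizers {1..i} (KR_F i A l))"

definition p_minus :: "nat \<Rightarrow> nat \<Rightarrow> arr \<Rightarrow> nat \<Rightarrow> nat" where
  "p_minus n i A l = Max (maximizers {i..n} (KR_G n i A l))"

definition q_minus :: "nat \<Rightarrow> nat \<Rightarrow> arr \<Rightarrow> nat \<Rightarrow> nat" where
  "q_minus n i A l = Min (maximizers {i..n} (KR_G n i A l))"

definition KR_phi :: "nat \<Rightarrow> nat \<Rightarrow> nat \<Rightarrow> nat \<Rightarrow> arr \<Rightarrow> int" where
  "KR_phi n i m l A =
     (if l = 0 then int (A 1 n)
      else if l = i then
        int m - (\<Sum>j\<in>{1..<i}. int (A j i)) - (\<Sum>j=i..n. int (A i j))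
      else if l > i then
        (\<Sum>j=1..p_plus i A l. int (A j (l - 1))) - (\<Sum>j\<in>{1..<p_plus i A l}. int (A j l))
      else
        (\<Sum>j=p_minus n i A l..n. int (A (l + 1) j)) -
        (\<Sum>j=p_minus n i A l + 1..n. int (A l j)))"

definition KR_eps :: "nat \<Rightarrow> nat \<Rightarrow> nat \<Rightarrow> nat \<Rightarrow> arr \<Rightarrow> int" where
  "KR_eps n i m l A =
     (if l = 0 then
        int m - (\<Sum>j=i..n. int (A 1 j)) - (\<Sum>j=2..i. int (A j n))
      else if l = i then int (A i i)
      else if l > i then
        (\<Sum>j=q_plus i A l..i. int (A j l)) - (\<Sum>j=q_plus i A l + 1..i. int (A j (l - 1)))
      else
        (\<Sum>j=i..q_minus n i A l. int (A l j)) -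
        (\<Sum>j\<in>{i..<q_minus n i A l}. int (A (l + 1) j)))"

definition upd :: "arr \<Rightarrow> nat \<Rightarrow> nat \<Rightarrow> nat \<Rightarrow> arr" where
  "upd A p q x = A(p := (A p)(q := x))"

definition incr :: "nat \<Rightarrow> nat \<Rightarrow> arr \<Rightarrow> arr" where
  "incr p q A = upd A p q (A p q + 1)"

text \<open>The subtraction is never truncated below: the entries that the operators decrease are
  positive whenever the respective \<open>KR_phi\<close> or \<open>KR_eps\<close> is nonzero.\<close>

definition decr :: "nat \<Rightarrow> nat \<Rightarrow> arr \<Rightarrow> arr" where
  "decr p q A = upd A p q (A p q - 1)"

definition KR_f :: "nat \<Rightarrow> nat \<Rightarrow> nat \<Rightarrow> nat \<Rightarrow> arr \<Rightarrow> arr option" where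
  "KR_f n i m l A =
     (if KR_phi n i m l A = 0 then None
      else if l = 0 then Some (decr 1 n A)
      else if l = i then Some (incr i i A)
      else if l > i then
        (let p = p_plus i A l in Some (incr p l (decr p (l - 1) A)))
      else
        (let p = p_minus n i A l in Some (incr l p (decr (l + 1) p A))))"

definition KR_e :: "nat \<Rightarrow> nat \<Rightarrow> nat \<Rightarrow> nat \<Rightarrow> arr \<Rightarrow> arr option" where
  "KR_e n i m l A =
     (if KR_eps n i m l A = 0 then None
      else if l = 0 then Some (incr 1 n A)
      else if l = i then Some (decr i i A)
      else if l > i then
        (let q = q_plus i A l in Some (incr q (l - 1) (decr q l A)))
      else
        (let q = q_minus n i A l in Some (incr (l + 1) q (decr l q A))))"

definition KR :: "nat \<Rightarrow> nat \<Rightarrow> nat \<Rightarrow> arr crystal" where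
  "KR n i m = \<lparr>
     elems = KR_elems n i m,
     wt = KR_wt n i m,
     eps = KR_eps n i m,
     phi = KR_phi n i m,
     etil = KR_e n i m,
     ftil = KR_f n i m \<rparr>"


section \<open>The sequence \<open>(A\<^sup>s\<^sub>r, B\<^sup>s\<^sub>r)\<close>\<close>

text \<open>The conversion \<open>nat\<close> sends negative integers to \<open>0\<close>, so the first exponent is the
  positive part \<open>(\<epsilon>\<^sub>t(A) - \<phi>\<^sub>t(B))\<^sub>+\<close>.\<close>

definition raise_step :: "'a crystal \<Rightarrow> 'b crystal \<Rightarrow> nat \<Rightarrow> 'a \<times> 'b \<Rightarrow> 'a \<times> 'b" where
  "raise_step B1 B2 t = (\<lambda>(A, B).
     (etil_pow B1 t (nat (eps B1 t A - phi B2 t B)) A, etil_pow B2 t (nat (eps B2 t B)) B))"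

text \<open>The index \<open>t\<close> of the operator used to pass from \<open>(A\<^sup>s\<^sub>r\<^sub>-\<^sub>1, B\<^sup>s\<^sub>r\<^sub>-\<^sub>1)\<close> to \<open>(A\<^sup>s\<^sub>r, B\<^sup>s\<^sub>r)\<close>. For
  \<open>s = 0\<close> this is \<open>t = r\<close> for all \<open>1 \<le> r \<le> r\<^sub>2\<close>.\<close>

definition raise_index :: "nat \<Rightarrow> nat \<Rightarrow> nat \<Rightarrow> nat" where
  "raise_index r2 s r = (if r < r2 then r else 2 * r2 + s - r)"

fun raise_seq ::
  "'a crystal \<Rightarrow> 'b crystal \<Rightarrow> nat \<Rightarrow> 'a \<times> 'b \<Rightarrow> nat \<Rightarrow> nat \<Rightarrow> 'a \<times> 'b" where
  "raise_seq B1 B2 r2 AB 0 0 = AB"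
| "raise_seq B1 B2 r2 AB (Suc s) 0 = raise_seq B1 B2 r2 AB s (r2 + s)"
| "raise_seq B1 B2 r2 AB s (Suc r) =
     raise_step B1 B2 (raise_index r2 s (Suc r)) (raise_seq B1 B2 r2 AB s r)"

definition pos_part :: "int \<Rightarrow> int" where
  "pos_part x = (if x > 0 then x else 0)"

end

theory Submission
  imports Defs
begin

text \<open>
  Write \<open>rect A\<close> for the sum of the entries of \<open>A\<close> in the columns \<open>p \<le> min r1 r2\<close> and the rows
  \<open>q \<ge> max r1 r2\<close>. The proof moves \<open>A \<otimes> B\<close> along classical raising operators, which do not change
  \<open>H\<close>, to an element \<open>A' \<otimes> 0\<close>, and then shows \<open>H (A' \<otimes> 0) = - rect A'\<close>.

  \<^emph>\<open>From \<open>A \<otimes> B\<close> to \<open>A' \<otimes> 0\<close>.\<close> By the tensor product rule, applying \<open>e\<^sub>t\<close> to \<open>A \<otimes> B\<close> as often as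
  possible first uses up the excess of \<open>\<epsilon>\<^sub>t(A)\<close> over \<open>\<phi>\<^sub>t(B)\<close> on the first factor and then acts
  \<open>\<epsilon>\<^sub>t(B)\<close> times on the second, so every step of the recursion for \<open>(A\<^sup>s\<^sub>r, B\<^sup>s\<^sub>r)\<close> is such a string
  and keeps \<open>H\<close> (\<open>raise_step_energy\<close>). The order of the indices is chosen so that stage \<open>s\<close> empties
  row \<open>r2 + s\<close> of the second factor: the operators \<open>e\<^sub>1, \<dots>\<close> push its entries into the last column,
  and the remaining ones carry them along this column to row \<open>r2\<close>, through rows that are already
  empty, and out of the array (\<open>cleared_step\<close>). After the last stage the second factor is \<open>0\<close>. Of all classical
  operators only \<open>e\<^sub>t\<close> with \<open>t = r2\<close> changes \<open>rect\<close> of the first factor; it lowers it by one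
  (\<open>rect_e\<close>). This operator ends each stage, so the sum in the formula is \<open>rect A - rect A'\<close>.

  \<^emph>\<open>The value at \<open>A \<otimes> 0\<close>.\<close> For \<open>l \<noteq> r2\<close> we have \<open>\<phi>\<^sub>l(0) = 0\<close>, so \<open>e\<^sub>l\<close>, whenever it does not
  annihilate \<open>A\<close>, acts on the first factor of \<open>A \<otimes> 0\<close>. This includes \<open>l = 0\<close>, and then \<open>e\<^sub>0\<close> acts
  on the first factor of the image under \<open>\<sigma>\<close> too: \<open>\<epsilon>\<^sub>0(A \<otimes> 0) = s2 + \<epsilon>\<^sub>0(A) > s2\<close>, whereas the second
  factor of the image contributes at most \<open>s1 \<le> s2\<close>. Hence \<open>e\<^sub>0\<close> lowers \<open>H\<close> by one
  (\<open>H_affine_step\<close>), just as it raises \<open>rect\<close> by one, and \<open>H (A \<otimes> 0) + rect A\<close> is constant along all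
  operators \<open>e\<^sub>l\<close> with \<open>l \<noteq> r2\<close>. It vanishes at \<open>A = 0\<close>, and these operators connect every \<open>A\<close> to \<open>0\<close>:
  raise with the classical ones until \<open>A\<close> is supported in the rectangle (\<open>eps_zero_support\<close>), then
  lower with indices below \<open>min r1 r2\<close> or above \<open>max r1 r2\<close>, which moves all entries to the corner
  \<open>(1, n)\<close>, where \<open>f\<^sub>0\<close> deletes them (\<open>phi_zero_imp_zero\<close>).

  Both parts need that the Kashiwara operators preserve the path inequalities that define the
  crystal. This rests on an exchange argument for two adjacent rows or columns
  (\<open>transfer_at_last_max\<close>, \<open>transfer_at_first_max\<close>, \<open>lpath_two_rows\<close>).
\<close>

section \<open>Two adjacent lines of an array\<close>

text \<open>
  The weight of a path that follows the line \<open>x\<close> from position \<open>c\<close> to \<open>t\<close>, crosses over, and follows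
  the adjacent line \<open>y\<close> from \<open>t\<close> to \<open>d\<close>. Over the full range of positions, as a function of \<open>t\<close>, this
  is also the function whose maximisers govern the operators: \<open>F\<^sub>l\<close> for the rows \<open>l - 1\<close> and \<open>l\<close>,
  and \<open>G\<^sub>l\<close> for the columns \<open>l\<close> and \<open>l + 1\<close>.
\<close>

definition zig :: "(nat \<Rightarrow> nat) \<Rightarrow> (nat \<Rightarrow> nat) \<Rightarrow> nat \<Rightarrow> nat \<Rightarrow> nat \<Rightarrow> nat" where
  "zig x y c d t = (\<Sum>j=c..t. x j) + (\<Sum>j=t..d. y j)"

definition peak :: "(nat \<Rightarrow> nat) \<Rightarrow> (nat \<Rightarrow> nat) \<Rightarrow> nat \<Rightarrow> nat \<Rightarrow> nat" where
  "peak x y a b = Max (zig x y a b ` {a..b})"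

definition first_max :: "nat \<Rightarrow> nat \<Rightarrow> (nat \<Rightarrow> nat) \<Rightarrow> nat \<Rightarrow> bool" where
  "first_max a b g q \<longleftrightarrow>
     q \<in> {a..b} \<and> (\<forall>p\<in>{a..b}. g p \<le> g q) \<and> (\<forall>p\<in>{a..b}. p < q \<longrightarrow> g p < g q)"

definition last_max :: "nat \<Rightarrow> nat \<Rightarrow> (nat \<Rightarrow> nat) \<Rightarrow> nat \<Rightarrow> bool" where
  "last_max a b g q \<longleftrightarrow>
     q \<in> {a..b} \<and> (\<forall>p\<in>{a..b}. g p \<le> g q) \<and> (\<forall>p\<in>{a..b}. q < p \<longrightarrow> g p < g q)"

lemma maximizers_nonempty:
  assumes "a \<le> b"
  shows "maximizers {a..b} g \<noteq> {}"
proof -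
  have "Max (g ` {a..b}) \<in> g ` {a..b}" using assms by (intro Max_in) auto
  then obtain p where p: "p \<in> {a..b}" "g p = Max (g ` {a..b})" by auto
  have "p \<in> maximizers {a..b} g" unfolding maximizers_def using p by auto
  then show ?thesis by blast
qed

lemma finite_maximizers: "finite (maximizers {a..b::nat} g)"
  unfolding maximizers_def by simp

lemma first_max_Min:
  assumes "a \<le> b"
  shows "first_max a b g (Min (maximizers {a..b} g))"
proof -
  let ?q = "Min (maximizers {a..b} g)"
  have q: "?q \<in> maximizers {a..b} g"
    using maximizers_nonempty[OF assms] finite_maximizers by (rule Min_in[rotated])
  have "g p < g ?q" if "p \<in> {a..b}" "p < ?q" for p
  proof (rule ccontr)
    assume "\<not> g p < g ?q"
    then have "p \<in> maximizers {a..b} g" using q that unfolding maximizers_def by force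
    then have "?q \<le> p" using finite_maximizers by (rule Min_le[rotated])
    then show False using that by simp
  qed
  then show ?thesis using q unfolding first_max_def maximizers_def by auto
qed

lemma last_max_Max:
  assumes "a \<le> b"
  shows "last_max a b g (Max (maximizers {a..b} g))"
proof -
  let ?q = "Max (maximizers {a..b} g)"
  have q: "?q \<in> maximizers {a..b} g"
    using maximizers_nonempty[OF assms] finite_maximizers by (rule Max_in[rotated])
  have "g p < g ?q" if "p \<in> {a..b}" "?q < p" for p
  proof (rule ccontr)
    assume "\<not> g p < g ?q"
    then have "p \<in> maximizers {a..b} g" using q that unfolding maximizers_def by force
    then have "p \<le> ?q" using finite_maximizers by (rule Max_ge[rotated])
    then show False using that by simp
  qed
  then show ?thesis using q unfolding last_max_def maximizers_def by auto
qed

lemma first_max_unique: "first_max a b g p \<Longrightarrow> first_max a b g q \<Longrightarrow> p = q"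
  unfolding first_max_def by (meson leD linorder_neqE_nat)

lemma last_max_unique: "last_max a b g p \<Longrightarrow> last_max a b g q \<Longrightarrow> p = q"
  unfolding last_max_def by (meson leD linorder_neqE_nat)

lemma peak_eqI:
  assumes "q \<in> {a..b}" "\<And>p. p \<in> {a..b} \<Longrightarrow> zig x y a b p \<le> zig x y a b q"
  shows "peak x y a b = zig x y a b q"
  unfolding peak_def using assms by (intro Max_eqI) auto

lemma zig_le_peak: "t \<in> {a..b} \<Longrightarrow> zig x y a b t \<le> peak x y a b"
  unfolding peak_def by (intro Max_ge) auto

lemma sum_raise:
  fixes x :: "nat \<Rightarrow> nat"
  shows "(\<Sum>j=c..d. (x(q := x q + 1)) j) = (\<Sum>j=c..d. x j) + (if c \<le> q \<and> q \<le> d then 1 else 0)"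
proof -
  have "(\<Sum>j=c..d. (x(q := x q + 1)) j) = (\<Sum>j=c..d. x j + (if j = q then 1 else 0))"
    by (intro sum.cong) auto
  then show ?thesis by (simp add: sum.distrib)
qed

lemma sum_lower:
  fixes x :: "nat \<Rightarrow> nat"
  assumes "0 < x q"
  shows "(\<Sum>j=c..d. (x(q := x q - 1)) j) + (if c \<le> q \<and> q \<le> d then 1 else 0) = (\<Sum>j=c..d. x j)"
proof -
  have "(x(q := x q - 1))(q := (x(q := x q - 1)) q + 1) = x" using assms by auto
  then show ?thesis using sum_raise[of "x(q := x q - 1)" q c d] by simp
qed

lemma zig_transfer:
  assumes "0 < y q"
  shows "zig (x(q := x q + 1)) (y(q := y q - 1)) c d t + (if t \<le> q \<and> q \<le> d then 1 else 0)
       = zig x y c d t + (if c \<le> q \<and> q \<le> t then 1 else 0)"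
  unfolding zig_def using sum_raise[of x q c t] sum_lower[of y q t d, OF assms] by simp

lemma zig_transfer':
  assumes "0 < x q"
  shows "zig (x(q := x q - 1)) (y(q := y q + 1)) c d t + (if c \<le> q \<and> q \<le> t then 1 else 0)
       = zig x y c d t + (if t \<le> q \<and> q \<le> d then 1 else 0)"
  unfolding zig_def using sum_lower[of x q c t, OF assms] sum_raise[of y q t d] by simp

text \<open>
  Outside \<open>{c..d}\<close> every path of the full range behaves in the same way, so the full range and
  \<open>{c..d}\<close> rank two crossing points in \<open>{c..d}\<close> with the same difference.
\<close>

lemma zig_exchange:
  assumes "a \<le> c" "c \<le> s" "s \<le> d" "d \<le> b" "c \<le> t" "t \<le> d"
  shows "zig x y c d s + zig x y a b t = zig x y c d t + zig x y a b s"
proof -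
  have 1: "(\<Sum>j=a..u. x j) = (\<Sum>j\<in>{a..<c}. x j) + (\<Sum>j=c..u. x j)" if "c \<le> u" for u
    using that assms(1) by (simp add: ivl_disj_un sum.union_disjoint[symmetric] ivl_disj_int_two)
  have 2: "(\<Sum>j=u..b. y j) = (\<Sum>j=u..d. y j) + (\<Sum>j\<in>{d<..b}. y j)" if "u \<le> d" for u
    using that assms(4) by (simp add: ivl_disj_un sum.union_disjoint[symmetric] ivl_disj_int_two)
  show ?thesis unfolding zig_def using 1[of s] 1[of t] 2[of s] 2[of t] assms by simp
qed

lemma zig_left_end: "a \<le> b \<Longrightarrow> zig x y a b a = x a + (\<Sum>j=a..b. y j)"
  unfolding zig_def by simp

lemma zig_right_end: "a \<le> b \<Longrightarrow> zig x y a b b = (\<Sum>j=a..b. x j) + y b"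
  unfolding zig_def by simp

lemma sum_le_peak:
  assumes "a \<le> b"
  shows "(\<Sum>j=a..b. x j) \<le> peak x y a b" "(\<Sum>j=a..b. y j) \<le> peak x y a b"
  using zig_le_peak[of b a b x y] zig_le_peak[of a a b x y] assms
  by (simp_all add: zig_left_end zig_right_end)

lemma zig_Suc:
  assumes "a \<le> t" "t < b"
  shows "zig x y a b (Suc t) + y t = zig x y a b t + x (Suc t)"
  unfolding zig_def using assms by (simp add: sum.atLeast_Suc_atMost[of t b])

text \<open>
  This and the next lemma guarantee that the subtraction in the operators is not truncated.
\<close>

lemma last_max_pos:
  assumes "last_max a b (zig x y a b) q" "(\<Sum>j=a..b. x j) < peak x y a b"
  shows "0 < y q"
proof (cases "q = b")
  case True
  have "peak x y a b = zig x y a b q" using assms(1) unfolding last_max_def by (intro peak_eqI) auto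
  then show ?thesis using True assms unfolding last_max_def by (simp add: zig_right_end)
next
  case False
  then have "zig x y a b (Suc q) < zig x y a b q" "a \<le> q" "q < b"
    using assms(1) unfolding last_max_def by auto
  then show ?thesis using zig_Suc[of a q b x y] by simp
qed

lemma first_max_pos:
  assumes "first_max a b (zig x y a b) q" "(\<Sum>j=a..b. y j) < peak x y a b"
  shows "0 < x q"
proof (cases "q = a")
  case True
  have "peak x y a b = zig x y a b q" using assms(1) unfolding first_max_def by (intro peak_eqI) auto
  then show ?thesis using True assms unfolding first_max_def by (simp add: zig_left_end)
next
  case False
  then obtain t where t: "q = Suc t" "a \<le> t" "t < b"
    using assms(1) unfolding first_max_def by (cases q) auto
  then have "zig x y a b t < zig x y a b (Suc t)" using assms(1) unfolding first_max_def by auto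
  then show ?thesis using zig_Suc[of a t b x y] t by simp
qed

text \<open>
  Moving a unit from \<open>y\<close> to \<open>x\<close> at \<open>q\<close> changes the weight of the path crossing at \<open>t\<close> by \<open>1\<close> for
  \<open>q < t\<close>, by \<open>0\<close> for \<open>q = t\<close> and by \<open>-1\<close> for \<open>t < q\<close>, if its range contains \<open>q\<close>. Since \<open>q\<close> is the
  last maximiser, the paths that gain were not maximal: the peak stays the same and \<open>q\<close> becomes the
  first maximiser. For the same reason a path that gains a unit was strictly lighter than the one
  crossing at \<open>q\<close>, and so no path inequality can become violated (third claim).
\<close>

lemma transfer_at_last_max:
  assumes q: "last_max a b (zig x y a b) q" and pos: "0 < y q"
  defines "x' \<equiv> x(q := x q + 1)" and "y' \<equiv> y(q := y q - 1)"
  shows "peak x' y' a b = peak x y a b" "first_max a b (zig x' y' a b) q"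
    and "\<lbrakk>a \<le> c; c \<le> t; t \<le> d; d \<le> b\<rbrakk> \<Longrightarrow> \<exists>t'\<in>{c..d}. zig x' y' c d t \<le> zig x y c d t'"
proof -
  note tr = zig_transfer[of y q x, OF pos, folded x'_def y'_def]
  have ab: "a \<le> q" "q \<le> b" using q unfolding last_max_def by auto
  have eq: "zig x' y' a b q = zig x y a b q" using tr[of a b q] ab by simp
  have F: "zig x y a b p \<le> zig x y a b q" "q < p \<Longrightarrow> zig x y a b p < zig x y a b q"
    if "p \<in> {a..b}" for p
    using q that unfolding last_max_def by auto
  have le: "zig x' y' a b p \<le> zig x y a b q" if "p \<in> {a..b}" for p
    using tr[of a b p] F[OF that] ab that by (cases p q rule: linorder_cases) auto
  have lt: "zig x' y' a b p < zig x y a b q" if "p \<in> {a..b}" "p < q" for p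
    using tr[of a b p] F[OF that(1)] ab that by auto
  have "peak x' y' a b = zig x' y' a b q" using le ab eq by (intro peak_eqI) auto
  moreover have "peak x y a b = zig x y a b q"
    using q unfolding last_max_def by (intro peak_eqI) auto
  ultimately show "peak x' y' a b = peak x y a b" using eq by simp
  show "first_max a b (zig x' y' a b) q" using le lt eq ab unfolding first_max_def by simp
  show "\<exists>t'\<in>{c..d}. zig x' y' c d t \<le> zig x y c d t'"
    if cd: "a \<le> c" "c \<le> t" "t \<le> d" "d \<le> b"
  proof (cases "c \<le> q \<and> q < t")
    case True
    then have "zig x y a b t < zig x y a b q" using q cd unfolding last_max_def by simp
    moreover have "zig x y c d q + zig x y a b t = zig x y c d t + zig x y a b q"
      using True cd by (intro zig_exchange) auto
    ultimately have "zig x' y' c d t \<le> zig x y c d q" using tr[of c d t] True by simp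
    then show ?thesis using True cd by (intro bexI[of _ q]) auto
  next
    case False
    then have "zig x' y' c d t \<le> zig x y c d t" using tr[of c d t] cd by (auto split: if_splits)
    then show ?thesis using cd by (intro bexI[of _ t]) auto
  qed
qed

text \<open>
  The mirror image of the previous lemma. Since each of the two moves turns a first into a last
  maximiser or conversely, they undo each other.
\<close>

lemma transfer_at_first_max:
  assumes q: "first_max a b (zig x y a b) q" and pos: "0 < x q"
  defines "x' \<equiv> x(q := x q - 1)" and "y' \<equiv> y(q := y q + 1)"
  shows "peak x' y' a b = peak x y a b" "last_max a b (zig x' y' a b) q"
    and "\<lbrakk>a \<le> c; c \<le> t; t \<le> d; d \<le> b\<rbrakk> \<Longrightarrow> \<exists>t'\<in>{c..d}. zig x' y' c d t \<le> zig x y c d t'"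
proof -
  note tr = zig_transfer'[of x q y, OF pos, folded x'_def y'_def]
  have ab: "a \<le> q" "q \<le> b" using q unfolding first_max_def by auto
  have eq: "zig x' y' a b q = zig x y a b q" using tr[of a b q] ab by simp
  have F: "zig x y a b p \<le> zig x y a b q" "p < q \<Longrightarrow> zig x y a b p < zig x y a b q"
    if "p \<in> {a..b}" for p
    using q that unfolding first_max_def by auto
  have le: "zig x' y' a b p \<le> zig x y a b q" if "p \<in> {a..b}" for p
    using tr[of a b p] F[OF that] ab that by (cases p q rule: linorder_cases) auto
  have lt: "zig x' y' a b p < zig x y a b q" if "p \<in> {a..b}" "q < p" for p
    using tr[of a b p] F[OF that(1)] ab that by auto
  have "peak x' y' a b = zig x' y' a b q" using le ab eq by (intro peak_eqI) auto
  moreover have "peak x y a b = zig x y a b q"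
    using q unfolding first_max_def by (intro peak_eqI) auto
  ultimately show "peak x' y' a b = peak x y a b" using eq by simp
  show "last_max a b (zig x' y' a b) q" using le lt eq ab unfolding last_max_def by simp
  show "\<exists>t'\<in>{c..d}. zig x' y' c d t \<le> zig x y c d t'"
    if cd: "a \<le> c" "c \<le> t" "t \<le> d" "d \<le> b"
  proof (cases "t < q \<and> q \<le> d")
    case True
    then have "zig x y a b t < zig x y a b q" using q cd unfolding first_max_def by simp
    moreover have "zig x y c d q + zig x y a b t = zig x y c d t + zig x y a b q"
      using True cd by (intro zig_exchange) auto
    ultimately have "zig x' y' c d t \<le> zig x y c d q" using tr[of c d t] True by simp
    then show ?thesis using True cd by (intro bexI[of _ q]) auto
  next
    case False
    then have "zig x' y' c d t \<le> zig x y c d t" using tr[of c d t] cd by (auto split: if_splits)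
    then show ?thesis using cd by (intro bexI[of _ t]) auto
  qed
qed

section \<open>Lattice paths\<close>

text \<open>
  \<open>lpath a p0 q0 p q w\<close>: some lattice path from \<open>(p0, q0)\<close> to \<open>(p, q)\<close> has weight \<open>w\<close> in \<open>a\<close>. This
  inductive form of the paths in \<^const>\<open>KR_path\<close> allows induction along a path, and transposing
  the array exchanges its two step rules.
\<close>

inductive lpath :: "arr \<Rightarrow> nat \<Rightarrow> nat \<Rightarrow> nat \<Rightarrow> nat \<Rightarrow> nat \<Rightarrow> bool" for a p0 q0 where
  start: "lpath a p0 q0 p0 q0 (a p0 q0)"
| right: "lpath a p0 q0 p q w \<Longrightarrow> lpath a p0 q0 (Suc p) q (w + a (Suc p) q)"
| up: "lpath a p0 q0 p q w \<Longrightarrow> lpath a p0 q0 p (Suc q) (w + a p (Suc q))"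

lemma lpath_ge: "lpath a p0 q0 p q w \<Longrightarrow> p0 \<le> p \<and> q0 \<le> q"
  by (induction rule: lpath.induct) auto

lemma lpath_transpose:
  "lpath a p0 q0 p q w \<Longrightarrow> lpath (\<lambda>x y. a y x) q0 p0 q p w"
  by (induction rule: lpath.induct) (auto intro: lpath.intros)

lemma lpath_mono:
  assumes "lpath a' p0 q0 p q w'" "\<And>x y. a' x y \<le> a x y"
  shows "\<exists>w\<ge>w'. lpath a p0 q0 p q w"
  using assms(1)
proof (induction rule: lpath.induct)
  case start
  then show ?case using assms(2) by (intro exI[of _ "a p0 q0"]) (auto intro: lpath.intros)
next
  case (right p q w)
  then obtain v where "v \<ge> w" "lpath a p0 q0 p q v" by blast
  then show ?case using assms(2)[of "Suc p" q]
    by (intro exI[of _ "v + a (Suc p) q"]) (auto intro: lpath.intros)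
next
  case (up p q w)
  then obtain v where "v \<ge> w" "lpath a p0 q0 p q v" by blast
  then show ?case using assms(2)[of p "Suc q"]
    by (intro exI[of _ "v + a p (Suc q)"]) (auto intro: lpath.intros)
qed

lemma lpath_along_row:
  assumes "lpath a p0 q0 c q (u + a c q)" "c \<le> t"
  shows "lpath a p0 q0 t q (u + (\<Sum>j=c..t. a j q))"
  using assms(2)
proof (induction t rule: dec_induct)
  case base
  then show ?case using assms(1) by simp
next
  case (step t)
  then show ?case using lpath.right[OF step.IH] by (simp add: add.assoc)
qed

lemma lpath_along_column:
  assumes "lpath a p0 q0 p c (u + a p c)" "c \<le> t"
  shows "lpath a p0 q0 p t (u + (\<Sum>j=c..t. a p j))"
  using lpath_transpose[OF lpath_along_row[OF lpath_transpose[OF assms(1)] assms(2)]] by simp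

text \<open>
  If within the rows \<open>k\<close> and \<open>k + 1\<close> every path of \<open>a'\<close> is dominated by one of \<open>a\<close> with the same
  entrance and exit, then replacing this section of a path dominates the whole path. The induction
  remembers, while the path is inside the two rows, where and with which weight it entered.
\<close>

lemma lpath_two_rows:
  assumes same: "\<And>p q. q \<noteq> k \<Longrightarrow> q \<noteq> Suc k \<Longrightarrow> a' p q = a p q"
    and dom: "\<And>c t d. p0 \<le> c \<Longrightarrow> c \<le> t \<Longrightarrow> t \<le> d \<Longrightarrow> d \<le> b \<Longrightarrow>
      \<exists>t'\<in>{c..d}. zig (\<lambda>j. a' j k) (\<lambda>j. a' j (Suc k)) c d t \<le> zig (\<lambda>j. a j k) (\<lambda>j. a j (Suc k)) c d t'"
    and "q0 \<le> k" and path: "lpath a' p0 q0 p q w'" and "p \<le> b" "q \<noteq> k"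
  shows "\<exists>w\<ge>w'. lpath a p0 q0 p q w"
proof -
  \<comment> \<open>\<open>u\<close> is the weight collected before row \<open>k\<close> is entered in column \<open>c\<close>; it is \<open>0\<close> if the path
    starts there.\<close>
  define entry where
    "entry c u \<longleftrightarrow> p0 \<le> c \<and> lpath a p0 q0 c k (u + a c k)" for c u
  define T where "T c d t = zig (\<lambda>j. a j k) (\<lambda>j. a j (Suc k)) c d t" for c d t
  define T' where "T' c d t = zig (\<lambda>j. a' j k) (\<lambda>j. a' j (Suc k)) c d t" for c d t
  have T: "lpath a p0 q0 d (Suc k) (u + T c d t)" if "entry c u" "c \<le> t" "t \<le> d" for c d t u
  proof -
    have "lpath a p0 q0 t k (u + (\<Sum>j=c..t. a j k))"
      using that unfolding entry_def by (intro lpath_along_row) auto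
    from lpath_along_row[OF lpath.up[OF this] that(3)] show ?thesis
      unfolding T_def zig_def by (simp add: add.assoc)
  qed
  have flat: "\<exists>v\<ge>w. lpath a p0 q0 d (Suc k) v"
    if "entry c u" "c \<le> t" "t \<le> d" "d \<le> b" "w \<le> u + T' c d t" for c d t u w
  proof -
    have "p0 \<le> c" using that(1) unfolding entry_def by simp
    then have "\<exists>t'\<in>{c..d}. T' c d t \<le> T c d t'"
      using dom[of c t d] that unfolding T_def T'_def by simp
    then obtain t' where t': "t' \<in> {c..d}" "T' c d t \<le> T c d t'" by blast
    then show ?thesis using T[of c u t' d] that by (intro exI[of _ "u + T c d t'"]) auto
  qed
  have "p \<le> b \<longrightarrow>
     (q < k \<longrightarrow> (\<exists>w\<ge>w'. lpath a p0 q0 p q w)) \<and>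
     (q = k \<longrightarrow> (\<exists>c u. entry c u \<and> c \<le> p \<and> w' \<le> u + (\<Sum>j=c..p. a' j k))) \<and>
     (q = Suc k \<longrightarrow> (\<exists>c u t. entry c u \<and> c \<le> t \<and> t \<le> p \<and> w' \<le> u + T' c p t)) \<and>
     (Suc k < q \<longrightarrow> (\<exists>w\<ge>w'. lpath a p0 q0 p q w))"
    using path
  proof (induction rule: lpath.induct)
    case start
    have "entry p0 0 \<and> p0 \<le> p0 \<and> a' p0 q0 \<le> 0 + (\<Sum>j=p0..p0. a' j k)" if "q0 = k"
      using that lpath.start[of a p0 q0] unfolding entry_def by simp
    moreover have "lpath a p0 q0 p0 q0 (a' p0 q0)" if "q0 < k"
      using same[of q0 p0] that lpath.start[of a p0 q0] by simp
    ultimately have "q0 = k \<Longrightarrow> \<exists>c u. entry c u \<and> c \<le> p0 \<and> a' p0 q0 \<le> u + (\<Sum>j=c..p0. a' j k)"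
      "q0 < k \<Longrightarrow> \<exists>w\<ge>a' p0 q0. lpath a p0 q0 p0 q0 w" by blast+
    then show ?case using \<open>q0 \<le> k\<close> by auto
  next
    case (right p q w)
    consider "b < Suc p" | "Suc p \<le> b" "q < k \<or> Suc k < q" | "Suc p \<le> b" "q = k"
      | "Suc p \<le> b" "q = Suc k" by linarith
    then show ?case
    proof cases
      case 2
      then obtain v where "v \<ge> w" "lpath a p0 q0 p q v" using right by auto
      then have "\<exists>v\<ge>w + a' (Suc p) q. lpath a p0 q0 (Suc p) q v"
        using same[of q "Suc p"] 2 by (intro exI[of _ "v + a (Suc p) q"]) (auto intro: lpath.right)
      then show ?thesis using 2 by auto
    next
      case 3
      then obtain c u where c: "entry c u" "c \<le> p" "w \<le> u + (\<Sum>j=c..p. a' j k)"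
        using right by auto
      then have "entry c u \<and> c \<le> Suc p \<and> w + a' (Suc p) q \<le> u + (\<Sum>j=c..Suc p. a' j k)"
        using 3 by simp
      then have "\<exists>c u. entry c u \<and> c \<le> Suc p \<and> w + a' (Suc p) q \<le> u + (\<Sum>j=c..Suc p. a' j k)"
        by blast
      then show ?thesis using 3 by simp
    next
      case 4
      then obtain c u t where c: "entry c u" "c \<le> t" "t \<le> p" "w \<le> u + T' c p t"
        using right by auto
      then have "entry c u \<and> c \<le> t \<and> t \<le> Suc p \<and> w + a' (Suc p) q \<le> u + T' c (Suc p) t"
        using 4 unfolding T'_def zig_def by simp
      then have "\<exists>c u t. entry c u \<and> c \<le> t \<and> t \<le> Suc p \<and> w + a' (Suc p) q \<le> u + T' c (Suc p) t"
        by blast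
      then show ?thesis using 4 by simp
    qed auto
  next
    case (up p q w)
    consider "b < p" | "p \<le> b" "Suc q < k" | "p \<le> b" "Suc q = k" | "p \<le> b" "q = k"
      | "p \<le> b" "k < q" by linarith
    then show ?case
    proof cases
      case 2
      then obtain v where "v \<ge> w" "lpath a p0 q0 p q v" using up by auto
      then have "\<exists>v\<ge>w + a' p (Suc q). lpath a p0 q0 p (Suc q) v"
        using same[of "Suc q" p] 2 by (intro exI[of _ "v + a p (Suc q)"]) (auto intro: lpath.up)
      then show ?thesis using 2 by auto
    next
      case 3
      then obtain v where v: "v \<ge> w" "lpath a p0 q0 p q v" using up by auto
      then have "entry p v \<and> p \<le> p \<and> w + a' p (Suc q) \<le> v + (\<Sum>j=p..p. a' j k)"
        using lpath.up[OF v(2)] lpath_ge[OF v(2)] 3 unfolding entry_def by auto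
      then have "\<exists>c u. entry c u \<and> c \<le> p \<and> w + a' p (Suc q) \<le> u + (\<Sum>j=c..p. a' j k)"
        by blast
      then show ?thesis using 3 by simp
    next
      case 4
      then obtain c u where c: "entry c u" "c \<le> p" "w \<le> u + (\<Sum>j=c..p. a' j k)"
        using up by auto
      then have "entry c u \<and> c \<le> p \<and> p \<le> p \<and> w + a' p (Suc q) \<le> u + T' c p p"
        using 4 unfolding T'_def zig_def by simp
      then have "\<exists>c u t. entry c u \<and> c \<le> t \<and> t \<le> p \<and> w + a' p (Suc q) \<le> u + T' c p t"
        by blast
      then show ?thesis using 4 by simp
    next
      case 5
      then have "\<exists>v\<ge>w. lpath a p0 q0 p q v"
        using up flat by (cases "q = Suc k") auto
      then obtain v where "v \<ge> w" "lpath a p0 q0 p q v" by auto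
      then have "\<exists>v\<ge>w + a' p (Suc q). lpath a p0 q0 p (Suc q) v"
        using same[of "Suc q" p] 5 by (intro exI[of _ "v + a p (Suc q)"]) (auto intro: lpath.up)
      then show ?thesis using 5 by auto
    qed auto
  qed
  then show ?thesis using \<open>p \<le> b\<close> \<open>q \<noteq> k\<close> flat by (cases "q = Suc k") (auto simp: not_less)
qed

lemma lpath_of_KR_path:
  assumes "KR_path n i \<beta>" "1 \<le> s" "s \<le> n"
  shows "lpath A 1 i (fst (\<beta> s)) (snd (\<beta> s)) (\<Sum>s=1..s. A (fst (\<beta> s)) (snd (\<beta> s)))"
  using assms(2,3)
proof (induction s rule: dec_induct)
  case base
  then show ?case using assms(1) lpath.start[of A 1 i] unfolding KR_path_def by simp
next
  case (step s)
  obtain p q where pq: "\<beta> s = (p, q)" by force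
  have "\<beta> (Suc s) = (p, q + 1) \<or> \<beta> (Suc s) = (p + 1, q)"
    using assms(1) step pq unfolding KR_path_def by auto
  moreover have "lpath A 1 i p q (\<Sum>s=1..s. A (fst (\<beta> s)) (snd (\<beta> s)))"
    using step pq by simp
  ultimately show ?case using step by (auto intro: lpath.intros)
qed

text \<open>
  A path reaches \<open>(p, q)\<close> at time \<open>p + q - i\<close>, since it starts at \<open>(1, i)\<close> at time \<open>1\<close>; the end point
  \<open>(i, n)\<close> is reached at time \<open>n\<close>.
\<close>

lemma KR_path_of_lpath:
  assumes "lpath A 1 i p q w"
  shows "\<exists>\<beta>. \<beta> 1 = (1, i) \<and> \<beta> (p + q - i) = (p, q) \<and>
     (\<forall>s\<in>{1..<p + q - i}. \<forall>x y. \<beta> s = (x, y) \<longrightarrow> \<beta> (s + 1) \<in> {(x, y + 1), (x + 1, y)}) \<and>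
     (\<Sum>s=1..p + q - i. A (fst (\<beta> s)) (snd (\<beta> s))) = w"
  using assms
proof (induction rule: lpath.induct)
  case start
  then show ?case by (intro exI[of _ "\<lambda>_. (1, i)"]) auto
next
  case (right p q w)
  then obtain \<beta> where b: "\<beta> 1 = (1, i)" "\<beta> (p + q - i) = (p, q)"
     "\<forall>s\<in>{1..<p + q - i}. \<forall>x y. \<beta> s = (x, y) \<longrightarrow> \<beta> (s + 1) \<in> {(x, y + 1), (x + 1, y)}"
     "(\<Sum>s=1..p + q - i. A (fst (\<beta> s)) (snd (\<beta> s))) = w" by blast
  define N where "N = p + q - i"
  have N: "Suc p + q - i = Suc N" "1 \<le> N" using lpath_ge[OF right.hyps] unfolding N_def by auto
  have "(\<Sum>s=1..N. A (fst ((\<beta>(Suc N := (Suc p, q))) s)) (snd ((\<beta>(Suc N := (Suc p, q))) s))) =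
      (\<Sum>s=1..N. A (fst (\<beta> s)) (snd (\<beta> s)))" by (intro sum.cong) auto
  then show ?case using b N unfolding N_def[symmetric] N(1)
    by (intro exI[of _ "\<beta>(Suc N := (Suc p, q))"]) (fastforce simp: less_Suc_eq)
next
  case (up p q w)
  then obtain \<beta> where b: "\<beta> 1 = (1, i)" "\<beta> (p + q - i) = (p, q)"
     "\<forall>s\<in>{1..<p + q - i}. \<forall>x y. \<beta> s = (x, y) \<longrightarrow> \<beta> (s + 1) \<in> {(x, y + 1), (x + 1, y)}"
     "(\<Sum>s=1..p + q - i. A (fst (\<beta> s)) (snd (\<beta> s))) = w" by blast
  define N where "N = p + q - i"
  have N: "p + Suc q - i = Suc N" "1 \<le> N" using lpath_ge[OF up.hyps] unfolding N_def by auto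
  have "(\<Sum>s=1..N. A (fst ((\<beta>(Suc N := (p, Suc q))) s)) (snd ((\<beta>(Suc N := (p, Suc q))) s))) =
      (\<Sum>s=1..N. A (fst (\<beta> s)) (snd (\<beta> s)))" by (intro sum.cong) auto
  then show ?case using b N unfolding N_def[symmetric] N(1)
    by (intro exI[of _ "\<beta>(Suc N := (p, Suc q))"]) (fastforce simp: less_Suc_eq)
qed

lemma KR_elems_iff:
  assumes "1 \<le> i" "i \<le> n"
  shows "A \<in> KR_elems n i m \<longleftrightarrow>
    (\<forall>p q. \<not> (p \<in> {1..i} \<and> q \<in> {i..n}) \<longrightarrow> A p q = 0) \<and> (\<forall>w. lpath A 1 i i n w \<longrightarrow> w \<le> m)"
proof -
  have "(\<Sum>s=1..n. A (fst (\<beta> s)) (snd (\<beta> s))) \<le> m"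
    if "\<forall>w. lpath A 1 i i n w \<longrightarrow> w \<le> m" "KR_path n i \<beta>" for \<beta>
    using that lpath_of_KR_path[OF that(2), of n A] assms unfolding KR_path_def by auto
  moreover have "w \<le> m"
    if "\<forall>\<beta>. KR_path n i \<beta> \<longrightarrow> (\<Sum>s=1..n. A (fst (\<beta> s)) (snd (\<beta> s))) \<le> m" "lpath A 1 i i n w" for w
    using KR_path_of_lpath[OF that(2)] that(1) unfolding KR_path_def by fastforce
  ultimately show ?thesis unfolding KR_elems_def by blast
qed


section \<open>The crystal structure of a single factor\<close>

lemma KR_F_zig: "KR_F i A l = zig (\<lambda>j. A j (l - 1)) (\<lambda>j. A j l) 1 i"
  unfolding KR_F_def zig_def by auto

lemma KR_G_zig: "KR_G n i A l = zig (A l) (A (Suc l)) i n"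
  unfolding KR_G_def zig_def by auto

lemma zig_minus_left:
  assumes "q \<in> {a..b}"
  shows "int (zig x y a b q) - (\<Sum>j=a..b. int (x j)) = (\<Sum>j=q..b. int (y j)) - (\<Sum>j=q+1..b. int (x j))"
proof -
  have "{a..b} = {a..q} \<union> {q+1..b}" using assms by auto
  then have "(\<Sum>j=a..b. int (x j)) = (\<Sum>j=a..q. int (x j)) + (\<Sum>j=q+1..b. int (x j))"
    by (simp add: sum.union_disjoint)
  then show ?thesis unfolding zig_def by simp
qed

lemma zig_minus_right:
  assumes "q \<in> {a..b}"
  shows "int (zig x y a b q) - (\<Sum>j=a..b. int (y j)) = (\<Sum>j=a..q. int (x j)) - (\<Sum>j\<in>{a..<q}. int (y j))"
proof -
  have "{a..b} = {a..<q} \<union> {q..b}" using assms by auto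
  moreover have "{a..<q} \<inter> {q..b} = {}" by auto
  ultimately have "(\<Sum>j=a..b. int (y j)) = (\<Sum>j\<in>{a..<q}. int (y j)) + (\<Sum>j=q..b. int (y j))"
    by (simp add: sum.union_disjoint)
  then show ?thesis unfolding zig_def by simp
qed

lemma last_max_peak: "last_max a b (zig x y a b) q \<Longrightarrow> zig x y a b q = peak x y a b \<and> q \<in> {a..b}"
  unfolding last_max_def by (metis peak_eqI)

lemma first_max_peak: "first_max a b (zig x y a b) q \<Longrightarrow> zig x y a b q = peak x y a b \<and> q \<in> {a..b}"
  unfolding first_max_def by (metis peak_eqI)

text \<open>
  Expressed through the peak, the string lengths become symmetric: they are the differences between
  the peak and the sums over the two lines. As an operator keeps the peak and moves one unit from
  one line to the other, its effect on both string lengths can be read off.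
\<close>

lemma KR_eps_right:
  assumes "1 \<le> i" "i < l"
  shows "KR_eps n i m l A
    = int (peak (\<lambda>j. A j (l - 1)) (\<lambda>j. A j l) 1 i) - (\<Sum>j=1..i. int (A j (l - 1)))"
  using assms last_max_peak[OF last_max_Max[OF assms(1), of "KR_F i A l", folded q_plus_def, unfolded KR_F_zig]]
    zig_minus_left[of "q_plus i A l" 1 i "\<lambda>j. A j (l - 1)" "\<lambda>j. A j l"]
  unfolding KR_eps_def by simp

lemma KR_phi_right:
  assumes "1 \<le> i" "i < l"
  shows "KR_phi n i m l A
    = int (peak (\<lambda>j. A j (l - 1)) (\<lambda>j. A j l) 1 i) - (\<Sum>j=1..i. int (A j l))"
  using assms first_max_peak[OF first_max_Min[OF assms(1), of "KR_F i A l", folded p_plus_def, unfolded KR_F_zig]]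
    zig_minus_right[of "p_plus i A l" 1 i "\<lambda>j. A j (l - 1)" "\<lambda>j. A j l"]
  unfolding KR_phi_def by simp

lemma KR_eps_left:
  assumes "i \<le> n" "1 \<le> l" "l < i"
  shows "KR_eps n i m l A = int (peak (A l) (A (Suc l)) i n) - (\<Sum>j=i..n. int (A (Suc l) j))"
  using assms first_max_peak[OF first_max_Min[OF assms(1), of "KR_G n i A l", folded q_minus_def, unfolded KR_G_zig]]
    zig_minus_right[of "q_minus n i A l" i n "A l" "A (Suc l)"]
  unfolding KR_eps_def by simp

lemma KR_phi_left:
  assumes "i \<le> n" "1 \<le> l" "l < i"
  shows "KR_phi n i m l A = int (peak (A l) (A (Suc l)) i n) - (\<Sum>j=i..n. int (A l j))"
  using assms last_max_peak[OF last_max_Max[OF assms(1), of "KR_G n i A l", folded p_minus_def, unfolded KR_G_zig]]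
    zig_minus_left[of "p_minus n i A l" i n "A l" "A (Suc l)"]
  unfolding KR_phi_def by simp

lemma KR_e_right:
  assumes "1 \<le> i" "i < l" "KR_e n i m l A = Some A'"
  obtains q where "last_max 1 i (zig (\<lambda>j. A j (l - 1)) (\<lambda>j. A j l) 1 i) q" "0 < A q l"
    "A' = incr q (l - 1) (decr q l A)"
proof -
  let ?q = "q_plus i A l"
  have lm: "last_max 1 i (zig (\<lambda>j. A j (l - 1)) (\<lambda>j. A j l) 1 i) ?q"
    using last_max_Max[OF assms(1), of "KR_F i A l"] unfolding q_plus_def KR_F_zig .
  have "KR_eps n i m l A \<noteq> 0" and A': "A' = incr ?q (l - 1) (decr ?q l A)"
    using assms unfolding KR_e_def by (auto simp: Let_def split: if_splits)
  then have "(\<Sum>j=1..i. A j (l - 1)) < peak (\<lambda>j. A j (l - 1)) (\<lambda>j. A j l) 1 i"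
    using KR_eps_right[OF assms(1,2), of n m A]
      sum_le_peak(1)[OF assms(1), of "\<lambda>j. A j (l - 1)" "\<lambda>j. A j l"]
    by (simp flip: of_nat_sum)
  from last_max_pos[OF lm this] show ?thesis using lm A' that by simp
qed

lemma KR_f_right:
  assumes "1 \<le> i" "i < l" "KR_f n i m l A = Some A'"
  obtains q where "first_max 1 i (zig (\<lambda>j. A j (l - 1)) (\<lambda>j. A j l) 1 i) q" "0 < A q (l - 1)"
    "A' = incr q l (decr q (l - 1) A)"
proof -
  let ?q = "p_plus i A l"
  have lm: "first_max 1 i (zig (\<lambda>j. A j (l - 1)) (\<lambda>j. A j l) 1 i) ?q"
    using first_max_Min[OF assms(1), of "KR_F i A l"] unfolding p_plus_def KR_F_zig .
  have "KR_phi n i m l A \<noteq> 0" and A': "A' = incr ?q l (decr ?q (l - 1) A)"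
    using assms unfolding KR_f_def by (auto simp: Let_def split: if_splits)
  then have "(\<Sum>j=1..i. A j l) < peak (\<lambda>j. A j (l - 1)) (\<lambda>j. A j l) 1 i"
    using KR_phi_right[OF assms(1,2), of n m A]
      sum_le_peak(2)[OF assms(1), of "\<lambda>j. A j l" "\<lambda>j. A j (l - 1)"]
    by (simp flip: of_nat_sum)
  from first_max_pos[OF lm this] show ?thesis using lm A' that by simp
qed

lemma KR_e_left:
  assumes "i \<le> n" "1 \<le> l" "l < i" "KR_e n i m l A = Some A'"
  obtains q where "first_max i n (zig (A l) (A (Suc l)) i n) q" "0 < A l q"
    "A' = incr (Suc l) q (decr l q A)"
proof -
  let ?q = "q_minus n i A l"
  have lm: "first_max i n (zig (A l) (A (Suc l)) i n) ?q"
    using first_max_Min[OF assms(1), of "KR_G n i A l"] unfolding q_minus_def KR_G_zig .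
  have "KR_eps n i m l A \<noteq> 0" and A': "A' = incr (Suc l) ?q (decr l ?q A)"
    using assms unfolding KR_e_def by (auto simp: Let_def split: if_splits)
  then have "(\<Sum>j=i..n. A (Suc l) j) < peak (A l) (A (Suc l)) i n"
    using KR_eps_left[OF assms(1,2,3), of m A] sum_le_peak(2)[OF assms(1), of "A (Suc l)" "A l"]
    by (simp flip: of_nat_sum)
  from first_max_pos[OF lm this] show ?thesis using lm A' that by simp
qed

lemma KR_f_left:
  assumes "i \<le> n" "1 \<le> l" "l < i" "KR_f n i m l A = Some A'"
  obtains q where "last_max i n (zig (A l) (A (Suc l)) i n) q" "0 < A (Suc l) q"
    "A' = incr l q (decr (Suc l) q A)"
proof -
  let ?q = "p_minus n i A l"
  have lm: "last_max i n (zig (A l) (A (Suc l)) i n) ?q"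
    using last_max_Max[OF assms(1), of "KR_G n i A l"] unfolding p_minus_def KR_G_zig .
  have "KR_phi n i m l A \<noteq> 0" and A': "A' = incr l ?q (decr (Suc l) ?q A)"
    using assms unfolding KR_f_def by (auto simp: Let_def split: if_splits)
  then have "(\<Sum>j=i..n. A l j) < peak (A l) (A (Suc l)) i n"
    using KR_phi_left[OF assms(1,2,3), of m A] sum_le_peak(1)[OF assms(1), of "A l" "A (Suc l)"]
    by (simp flip: of_nat_sum)
  from last_max_pos[OF lm this] show ?thesis using lm A' that by simp
qed

lemma KR_eps_nonneg:
  assumes "1 \<le> i" "i \<le> n" "1 \<le> l"
  shows "0 \<le> KR_eps n i m l A"
proof -
  consider "l = i" | "i < l" | "l < i" by linarith
  then show ?thesis
  proof cases
    case 1
    then show ?thesis using assms unfolding KR_eps_def by simp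
  next
    case 2
    then show ?thesis using KR_eps_right[of i l n m A] assms
        sum_le_peak(1)[of 1 i "\<lambda>j. A j (l - 1)" "\<lambda>j. A j l"] by (simp flip: of_nat_sum)
  next
    case 3
    then show ?thesis using KR_eps_left[of i n l m A] assms
        sum_le_peak(2)[of i n "A (Suc l)" "A l"] by (simp flip: of_nat_sum)
  qed
qed

text \<open>
  The two lattice paths with a single corner give \<open>\<epsilon>\<^sub>0 \<ge> 0\<close> and \<open>\<phi>\<^sub>i \<ge> 0\<close>.
\<close>

lemma hook_path:
  assumes "1 \<le> i" "i \<le> n" "A \<in> KR_elems n i m"
  shows "(\<Sum>j=i..n. A 1 j) + (\<Sum>j=2..i. A j n) \<le> m"
    and "(\<Sum>j\<in>{1..<i}. A j i) + (\<Sum>j=i..n. A i j) \<le> m"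
proof -
  have "lpath A 1 i 1 n (0 + (\<Sum>j=i..n. A 1 j))"
    using lpath.start[of A 1 i] assms by (intro lpath_along_column) auto
  then have "lpath A 1 i i n ((\<Sum>j\<in>{i..<n}. A 1 j) + (\<Sum>j=1..i. A j n))"
    using assms by (intro lpath_along_row) (auto simp: atLeastLessThanSuc_atLeastAtMost[symmetric])
  moreover have "(\<Sum>j=1..i. A j n) = A 1 n + (\<Sum>j=2..i. A j n)"
    using assms by (simp add: sum.atLeast_Suc_atMost numeral_2_eq_2)
  moreover have "(\<Sum>j=i..n. A 1 j) = (\<Sum>j\<in>{i..<n}. A 1 j) + A 1 n"
    using assms by (simp add: atLeastLessThanSuc_atLeastAtMost[symmetric])
  ultimately show "(\<Sum>j=i..n. A 1 j) + (\<Sum>j=2..i. A j n) \<le> m"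
    using assms KR_elems_iff[of i n A m] by auto
  have "lpath A 1 i i i (0 + (\<Sum>j=1..i. A j i))"
    using lpath.start[of A 1 i] assms by (intro lpath_along_row) auto
  then have "lpath A 1 i i n ((\<Sum>j\<in>{1..<i}. A j i) + (\<Sum>j=i..n. A i j))"
    using assms by (intro lpath_along_column) (auto simp: atLeastLessThanSuc_atLeastAtMost[symmetric])
  then show "(\<Sum>j\<in>{1..<i}. A j i) + (\<Sum>j=i..n. A i j) \<le> m"
    using assms KR_elems_iff[of i n A m] by auto
qed

lemma KR_phi_nonneg:
  assumes "1 \<le> i" "i \<le> n" "1 \<le> l" "A \<in> KR_elems n i m"
  shows "0 \<le> KR_phi n i m l A"
proof -
  consider "l = i" | "i < l" | "l < i" by linarith
  then show ?thesis
  proof cases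
    case 1
    then show ?thesis using assms hook_path(2)[of i n A m] unfolding KR_phi_def
      by (simp flip: of_nat_sum)
  next
    case 2
    then show ?thesis using KR_phi_right[of i l n m A] assms
        sum_le_peak(2)[of 1 i "\<lambda>j. A j l" "\<lambda>j. A j (l - 1)"] by (simp flip: of_nat_sum)
  next
    case 3
    then show ?thesis using KR_phi_left[of i n l m A] assms
        sum_le_peak(1)[of i n "A l" "A (Suc l)"] by (simp flip: of_nat_sum)
  qed
qed

lemma move_apply:
  assumes "(p, q) \<noteq> (p', q')"
  shows "incr p' q' (decr p q A) x y =
    (if (x, y) = (p', q') then A x y + 1 else if (x, y) = (p, q) then A x y - 1 else A x y)"
  using assms unfolding incr_def decr_def upd_def by auto

lemma move_rows:
  assumes "k \<noteq> k'"
  shows "(\<lambda>j. incr q k' (decr q k A) j k') = (\<lambda>j. A j k')(q := A q k' + 1)"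
    and "(\<lambda>j. incr q k' (decr q k A) j k) = (\<lambda>j. A j k)(q := A q k - 1)"
  using assms by (auto simp: move_apply)

lemma move_columns:
  assumes "k \<noteq> k'"
  shows "incr k' q (decr k q A) k' = (A k')(q := A k' q + 1)"
    and "incr k' q (decr k q A) k = (A k)(q := A k q - 1)"
  using assms by (auto simp: move_apply)

lemma KR_elems_supp:
  assumes "A \<in> KR_elems n i m" "\<not> (p \<in> {1..i} \<and> q \<in> {i..n})"
  shows "A p q = 0"
  using assms unfolding KR_elems_def by auto

lemma KR_elems_nonzero:
  assumes "A \<in> KR_elems n i m" "A p q \<noteq> 0"
  shows "p \<in> {1..i} \<and> q \<in> {i..n}"
  using assms unfolding KR_elems_def by (cases "p \<in> {1..i} \<and> q \<in> {i..n}") simp_all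

lemma KR_elems_row_move:
  assumes "1 \<le> i" "i \<le> n" "i < l" "l \<le> n" "A \<in> KR_elems n i m"
    and rows: "\<And>p q. q \<noteq> l - 1 \<Longrightarrow> q \<noteq> l \<Longrightarrow> A' p q = A p q"
    and supp: "\<And>p q. p \<notin> {1..i} \<Longrightarrow> A' p q = 0"
    and dom: "\<And>c t d. 1 \<le> c \<Longrightarrow> c \<le> t \<Longrightarrow> t \<le> d \<Longrightarrow> d \<le> i \<Longrightarrow>
      \<exists>t'\<in>{c..d}. zig (\<lambda>j. A' j (l - 1)) (\<lambda>j. A' j l) c d t
                  \<le> zig (\<lambda>j. A j (l - 1)) (\<lambda>j. A j l) c d t'"
  shows "A' \<in> KR_elems n i m"
proof -
  obtain k where k: "l = Suc k" using assms by (cases l) auto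
  have "w \<le> m" if w: "lpath A' 1 i i n w" for w
  proof -
    have "\<exists>v\<ge>w. lpath A 1 i i n v"
      using lpath_two_rows[where a=A and a'=A' and k=k and ?b=i, OF _ _ _ w] rows dom assms k by auto
    then show ?thesis using assms KR_elems_iff[of i n A m] by auto
  qed
  moreover have "A' p q = 0" if "\<not> (p \<in> {1..i} \<and> q \<in> {i..n})" for p q
  proof (cases "p \<in> {1..i}")
    case True
    then have "q \<notin> {i..n}" "q \<noteq> l - 1" "q \<noteq> l" using that assms by auto
    then show ?thesis using rows assms KR_elems_iff[of i n A m] by auto
  qed (use supp in auto)
  ultimately show ?thesis using assms KR_elems_iff[of i n A' m] by auto
qed

lemma KR_elems_column_move:
  assumes "1 \<le> i" "i \<le> n" "l < i" "1 \<le> l" "A \<in> KR_elems n i m"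
    and cols: "\<And>p q. p \<noteq> l \<Longrightarrow> p \<noteq> Suc l \<Longrightarrow> A' p q = A p q"
    and supp: "\<And>p q. q \<notin> {i..n} \<Longrightarrow> A' p q = 0"
    and dom: "\<And>c t d. i \<le> c \<Longrightarrow> c \<le> t \<Longrightarrow> t \<le> d \<Longrightarrow> d \<le> n \<Longrightarrow>
      \<exists>t'\<in>{c..d}. zig (A' l) (A' (Suc l)) c d t \<le> zig (A l) (A (Suc l)) c d t'"
  shows "A' \<in> KR_elems n i m"
proof -
  have "w \<le> m" if w: "lpath A' 1 i i n w" for w
  proof -
    have "\<exists>v\<ge>w. lpath (\<lambda>x y. A y x) i 1 n i v"
      using lpath_two_rows[where a="\<lambda>x y. A y x" and a'="\<lambda>x y. A' y x" and k=l and ?b=n,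
          OF _ _ _ lpath_transpose[OF w]] cols dom assms by auto
    then show ?thesis
      using assms KR_elems_iff[of i n A m] lpath_transpose[of "\<lambda>x y. A y x" i 1 n i] by fastforce
  qed
  moreover have "A' p q = 0" if "\<not> (p \<in> {1..i} \<and> q \<in> {i..n})" for p q
  proof (cases "q \<in> {i..n}")
    case True
    then have "p \<notin> {1..i}" "p \<noteq> Suc l" "p \<noteq> l" using that assms by auto
    then show ?thesis using cols assms KR_elems_iff[of i n A m] by auto
  qed (use supp in auto)
  ultimately show ?thesis using assms KR_elems_iff[of i n A' m] by auto
qed

lemma KR_elems_mono:
  assumes "1 \<le> i" "i \<le> n" "A \<in> KR_elems n i m" "\<And>p q. A' p q \<le> A p q"
  shows "A' \<in> KR_elems n i m"
proof -
  have "w \<le> m" if "lpath A' 1 i i n w" for w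
    using lpath_mono[OF that assms(4)] KR_elems_iff[of i n A m] assms by fastforce
  moreover have "A' p q = 0" if "\<not> (p \<in> {1..i} \<and> q \<in> {i..n})" for p q
    using assms(4)[of p q] KR_elems_supp[OF assms(3) that] by simp
  ultimately show ?thesis using assms KR_elems_iff[of i n A' m] by auto
qed

text \<open>
  A decrease of a single entry keeps the path inequalities; the moves between two lines are covered
  by the transfer lemmas.
\<close>

lemma KR_e_step:
  assumes i: "1 \<le> i" "i \<le> n" and l: "1 \<le> l" "l \<le> n" and A: "A \<in> KR_elems n i m"
    and e: "KR_e n i m l A = Some A'"
  shows "A' \<in> KR_elems n i m \<and> KR_eps n i m l A' = KR_eps n i m l A - 1
    \<and> KR_phi n i m l A' = KR_phi n i m l A + 1"
proof -
  consider "l = i" | "i < l" | "l < i" by linarith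
  then show ?thesis
  proof cases
    case 1
    then have A': "A' = decr i i A" "0 < A i i"
      using e i unfolding KR_e_def KR_eps_def by (auto split: if_splits)
    have "A' \<in> KR_elems n i m"
      by (rule KR_elems_mono[OF i A]) (auto simp: A'(1) decr_def upd_def)
    moreover have "(\<Sum>j\<in>{1..<i}. int (A' j i)) = (\<Sum>j\<in>{1..<i}. int (A j i))"
      by (intro sum.cong) (auto simp: A'(1) decr_def upd_def)
    moreover have "(\<Sum>j=i..n. int (A' i j)) = (\<Sum>j=i..n. int (A i j)) - 1"
    proof -
      have "A' i = (A i)(i := A i i - 1)" by (auto simp: A'(1) decr_def upd_def)
      then show ?thesis using sum_lower[of "A i" i i n] A'(2) i by (simp flip: of_nat_sum)
    qed
    ultimately show ?thesis using 1 i A'(2) unfolding KR_eps_def KR_phi_def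
      by (auto simp: A'(1) decr_def upd_def)
  next
    case 2
    obtain q where q: "last_max 1 i (zig (\<lambda>j. A j (l - 1)) (\<lambda>j. A j l) 1 i) q" "0 < A q l"
      "A' = incr q (l - 1) (decr q l A)" using KR_e_right[OF i(1) 2 e] .
    have qi: "1 \<le> q" "q \<le> i" using q(1) unfolding last_max_def by auto
    have r: "(\<lambda>j. A' j (l - 1)) = (\<lambda>j. A j (l - 1))(q := A q (l - 1) + 1)"
      "(\<lambda>j. A' j l) = (\<lambda>j. A j l)(q := A q l - 1)"
      using move_rows[of l "l - 1" q A] l unfolding q(3) by simp_all
    note tr = transfer_at_last_max[OF q(1,2), folded r]
    have "A' \<in> KR_elems n i m"
    proof (rule KR_elems_row_move[OF i 2 l(2) A _ _ tr(3)])
      show "A' x y = A x y" if "y \<noteq> l - 1" "y \<noteq> l" for x y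
        using that l q(3) by (simp add: move_apply)
      show "A' x y = 0" if "x \<notin> {1..i}" for x y
        using that l q(3) qi KR_elems_supp[OF A, of x y] by (auto simp: move_apply)
    qed
    moreover have "(\<Sum>j=1..i. A' j (l - 1)) = (\<Sum>j=1..i. A j (l - 1)) + 1"
      "(\<Sum>j=1..i. A' j l) + 1 = (\<Sum>j=1..i. A j l)"
      using sum_raise[of "\<lambda>j. A j (l - 1)" q 1 i] sum_lower[of "\<lambda>j. A j l" q 1 i] q(2) qi
      unfolding r[symmetric] by simp_all
    ultimately show ?thesis
      unfolding KR_eps_right[OF i(1) 2] KR_phi_right[OF i(1) 2] tr(1)
      by (simp flip: of_nat_sum)
  next
    case 3
    obtain q where q: "first_max i n (zig (A l) (A (Suc l)) i n) q" "0 < A l q"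
      "A' = incr (Suc l) q (decr l q A)" using KR_e_left[OF i(2) l(1) 3 e] .
    have qi: "i \<le> q" "q \<le> n" using q(1) unfolding first_max_def by auto
    have r: "A' l = (A l)(q := A l q - 1)" "A' (Suc l) = (A (Suc l))(q := A (Suc l) q + 1)"
      using move_columns[of l "Suc l" q A] unfolding q(3) by simp_all
    note tr = transfer_at_first_max[OF q(1,2), folded r]
    have "A' \<in> KR_elems n i m"
    proof (rule KR_elems_column_move[OF i 3 l(1) A _ _ tr(3)])
      show "A' x y = A x y" if "x \<noteq> l" "x \<noteq> Suc l" for x y
        using that l q(3) by (simp add: move_apply)
      show "A' x y = 0" if "y \<notin> {i..n}" for x y
        using that l q(3) qi KR_elems_supp[OF A, of x y] by (auto simp: move_apply)
    qed
    moreover have "(\<Sum>j=i..n. A' (Suc l) j) = (\<Sum>j=i..n. A (Suc l) j) + 1"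
      "(\<Sum>j=i..n. A' l j) + 1 = (\<Sum>j=i..n. A l j)"
      using sum_raise[of "A (Suc l)" q i n] sum_lower[of "A l" q i n] q(2) qi
      unfolding r[symmetric] by simp_all
    ultimately show ?thesis
      unfolding KR_eps_left[OF i(2) l(1) 3] KR_phi_left[OF i(2) l(1) 3] tr(1)
      by (simp flip: of_nat_sum)
  qed
qed

lemma move_back:
  assumes "(p, q) \<noteq> (p', q')" "0 < A p q"
  shows "incr p q (decr p' q' (incr p' q' (decr p q A))) = A"
  using assms unfolding incr_def decr_def upd_def by (auto simp: fun_eq_iff)

text \<open>
  Energy is defined through the raising operators only, so that a lowering step can be used
  once it is known to be undone by the raising operator of the same index.
\<close>

lemma KR_f_step:
  assumes i: "1 \<le> i" "i \<le> n" and l: "l \<le> n" "l \<noteq> i" and A: "A \<in> KR_elems n i m"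
    and f: "KR_f n i m l A = Some A'"
  shows "A' \<in> KR_elems n i m \<and> KR_e n i m l A' = Some A"
proof -
  consider "l = 0" | "i < l" | "1 \<le> l" "l < i" using l by linarith
  then show ?thesis
  proof cases
    case 1
    then have A': "A' = decr 1 n A" "0 < A 1 n"
      using f i unfolding KR_f_def KR_phi_def by (auto split: if_splits)
    have mem: "A' \<in> KR_elems n i m"
      by (rule KR_elems_mono[OF i A]) (auto simp: A'(1) decr_def upd_def)
    have "(\<Sum>j=2..i. A' j n) = (\<Sum>j=2..i. A j n)"
      by (intro sum.cong) (auto simp: A'(1) decr_def upd_def)
    moreover have "(\<Sum>j=i..n. A' 1 j) + 1 = (\<Sum>j=i..n. A 1 j)"
    proof -
      have "A' 1 = (A 1)(n := A 1 n - 1)" by (auto simp: A'(1) decr_def upd_def)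
      then show ?thesis using sum_lower[of "A 1" n i n] A'(2) i by simp
    qed
    ultimately have "KR_eps n i m 0 A' \<noteq> 0"
      using hook_path(1)[OF i A] i unfolding KR_eps_def by (simp flip: of_nat_sum)
    moreover have "incr 1 n A' = A"
      using A' unfolding incr_def decr_def upd_def by (auto simp: fun_eq_iff)
    ultimately show ?thesis using mem 1 unfolding KR_e_def by simp
  next
    case 2
    obtain q where q: "first_max 1 i (zig (\<lambda>j. A j (l - 1)) (\<lambda>j. A j l) 1 i) q" "0 < A q (l - 1)"
      "A' = incr q l (decr q (l - 1) A)" using KR_f_right[OF i(1) 2 f] .
    have qi: "1 \<le> q" "q \<le> i" using q(1) unfolding first_max_def by auto
    have r: "(\<lambda>j. A' j (l - 1)) = (\<lambda>j. A j (l - 1))(q := A q (l - 1) - 1)"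
      "(\<lambda>j. A' j l) = (\<lambda>j. A j l)(q := A q l + 1)"
      using move_rows[of "l - 1" l q A] 2 unfolding q(3) by simp_all
    note tr = transfer_at_first_max[OF q(1,2), folded r]
    have mem: "A' \<in> KR_elems n i m"
    proof (rule KR_elems_row_move[OF i 2 l(1) A _ _ tr(3)])
      show "A' x y = A x y" if "y \<noteq> l - 1" "y \<noteq> l" for x y
        using that 2 q(3) by (simp add: move_apply)
      show "A' x y = 0" if "x \<notin> {1..i}" for x y
        using that 2 q(3) qi KR_elems_supp[OF A, of x y] by (auto simp: move_apply)
    qed
    have "(\<Sum>j=1..i. A' j (l - 1)) + 1 = (\<Sum>j=1..i. A j (l - 1))"
      using sum_lower[of "\<lambda>j. A j (l - 1)" q 1 i] q(2) qi unfolding r[symmetric] by simp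
    then have "KR_eps n i m l A' \<noteq> 0"
      using sum_le_peak(1)[of 1 i "\<lambda>j. A j (l - 1)" "\<lambda>j. A j l"] i
      unfolding KR_eps_right[OF i(1) 2] tr(1) by (simp flip: of_nat_sum)
    moreover have "q_plus i A' l = q"
      using last_max_unique[OF last_max_Max[OF i(1)]] tr(2) unfolding q_plus_def KR_F_zig by simp
    moreover have "incr q (l - 1) (decr q l A') = A"
      unfolding q(3) using 2 q(2) by (intro move_back) auto
    ultimately show ?thesis using mem 2 unfolding KR_e_def by simp
  next
    case 3
    obtain q where q: "last_max i n (zig (A l) (A (Suc l)) i n) q" "0 < A (Suc l) q"
      "A' = incr l q (decr (Suc l) q A)" using KR_f_left[OF i(2) 3 f] .
    have qi: "i \<le> q" "q \<le> n" using q(1) unfolding last_max_def by auto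
    have r: "A' l = (A l)(q := A l q + 1)" "A' (Suc l) = (A (Suc l))(q := A (Suc l) q - 1)"
      using move_columns[of "Suc l" l q A] unfolding q(3) by simp_all
    note tr = transfer_at_last_max[OF q(1,2), folded r]
    have mem: "A' \<in> KR_elems n i m"
    proof (rule KR_elems_column_move[OF i 3(2,1) A _ _ tr(3)])
      show "A' x y = A x y" if "x \<noteq> l" "x \<noteq> Suc l" for x y
        using that q(3) by (simp add: move_apply)
      show "A' x y = 0" if "y \<notin> {i..n}" for x y
        using that q(3) qi KR_elems_supp[OF A, of x y] by (auto simp: move_apply)
    qed
    have "(\<Sum>j=i..n. A' (Suc l) j) + 1 = (\<Sum>j=i..n. A (Suc l) j)"
      using sum_lower[of "A (Suc l)" q i n] q(2) qi unfolding r[symmetric] by simp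
    then have "KR_eps n i m l A' \<noteq> 0"
      using sum_le_peak(2)[of i n "A (Suc l)" "A l"] i
      unfolding KR_eps_left[OF i(2) 3] tr(1) by (simp flip: of_nat_sum)
    moreover have "q_minus n i A' l = q"
      using first_max_unique[OF first_max_Min[OF i(2)]] tr(2) unfolding q_minus_def KR_G_zig by simp
    moreover have "incr (Suc l) q (decr l q A') = A"
      unfolding q(3) using q(2) by (intro move_back) auto
    ultimately show ?thesis using mem 3 unfolding KR_e_def by simp
  qed
qed


section \<open>Weighted sums of entries\<close>

definition wsum :: "nat set \<Rightarrow> nat set \<Rightarrow> (nat \<Rightarrow> nat \<Rightarrow> nat) \<Rightarrow> arr \<Rightarrow> nat" where
  "wsum P Q w A = (\<Sum>p\<in>P. \<Sum>q\<in>Q. A p q * w p q)"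

lemma wsum_incr:
  assumes "finite P" "finite Q"
  shows "wsum P Q w (incr a b A) = wsum P Q w A + (if a \<in> P \<and> b \<in> Q then w a b else 0)"
proof -
  have "incr a b A p q * w p q = A p q * w p q + (if q = b then if p = a then w a b else 0 else 0)"
    for p q
    unfolding incr_def upd_def by auto
  then have "wsum P Q w (incr a b A)
      = (\<Sum>p\<in>P. \<Sum>q\<in>Q. A p q * w p q + (if q = b then if p = a then w a b else 0 else 0))"
    unfolding wsum_def by simp
  also have "\<dots> = wsum P Q w A + (\<Sum>p\<in>P. if b \<in> Q then if p = a then w a b else 0 else 0)"
    unfolding wsum_def sum.distrib using assms by simp
  also have "(\<Sum>p\<in>P. if b \<in> Q then if p = a then w a b else 0 else 0)
      = (if a \<in> P \<and> b \<in> Q then w a b else 0)"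
    using assms by (cases "b \<in> Q") auto
  finally show ?thesis .
qed

lemma wsum_decr:
  assumes "finite P" "finite Q" "0 < A a b"
  shows "wsum P Q w (decr a b A) + (if a \<in> P \<and> b \<in> Q then w a b else 0) = wsum P Q w A"
proof -
  have "incr a b (decr a b A) = A"
    using assms(3) unfolding incr_def decr_def upd_def by (auto simp: fun_eq_iff)
  then show ?thesis using wsum_incr[OF assms(1,2), of w a b "decr a b A"] by simp
qed

lemma wsum_move:
  assumes "finite P" "finite Q" "0 < A a b"
  shows "wsum P Q w (incr c d (decr a b A)) + (if a \<in> P \<and> b \<in> Q then w a b else 0)
    = wsum P Q w A + (if c \<in> P \<and> d \<in> Q then w c d else 0)"
  using wsum_decr[of P Q A a b w, OF assms] wsum_incr[OF assms(1,2), of w c d "decr a b A"] by simp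

lemma KR_e_defined: "KR_eps n i m l A \<noteq> 0 \<Longrightarrow> \<exists>A'. KR_e n i m l A = Some A'"
  by (cases "KR_e n i m l A") (auto simp: KR_e_def Let_def split: if_splits)

lemma KR_f_defined: "KR_phi n i m l A \<noteq> 0 \<Longrightarrow> \<exists>A'. KR_f n i m l A = Some A'"
  by (cases "KR_f n i m l A") (auto simp: KR_f_def Let_def split: if_splits)

lemma KR_e_cases:
  assumes "1 \<le> i" "i \<le> n" "1 \<le> l" "l \<le> n" "KR_e n i m l A = Some A'"
  obtains (diag) "l = i" "0 < A i i" "A' = decr i i A"
  | (right) q where "i < l" "q \<in> {1..i}" "0 < A q l" "A' = incr q (l - 1) (decr q l A)"
  | (left) q where "l < i" "q \<in> {i..n}" "0 < A l q" "A' = incr (Suc l) q (decr l q A)"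
proof -
  consider "l = i" | "i < l" | "l < i" by linarith
  then show ?thesis
  proof cases
    case 1
    then show ?thesis using assms diag unfolding KR_e_def KR_eps_def by (auto split: if_splits)
  next
    case 2
    then show ?thesis
      using KR_e_right[OF assms(1) 2 assms(5)] right unfolding last_max_def by metis
  next
    case 3
    then show ?thesis
      using KR_e_left[OF assms(2,3) 3 assms(5)] left unfolding first_max_def by metis
  qed
qed

lemma KR_f_cases:
  assumes "1 \<le> i" "i \<le> n" "l \<le> n" "l \<noteq> i" "KR_f n i m l A = Some A'"
  obtains (affine) "l = 0" "0 < A 1 n" "A' = decr 1 n A"
  | (right) q where "i < l" "q \<in> {1..i}" "0 < A q (l - 1)" "A' = incr q l (decr q (l - 1) A)"
  | (left) q where "1 \<le> l" "l < i" "q \<in> {i..n}" "0 < A (Suc l) q"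
      "A' = incr l q (decr (Suc l) q A)"
proof -
  consider "l = 0" | "i < l" | "1 \<le> l" "l < i" using assms by linarith
  then show ?thesis
  proof cases
    case 1
    then show ?thesis using assms affine unfolding KR_f_def KR_phi_def by (auto split: if_splits)
  next
    case 2
    then show ?thesis
      using KR_f_right[OF assms(1) 2 assms(5)] right unfolding first_max_def by metis
  next
    case 3
    then show ?thesis
      using KR_f_left[OF assms(2) 3 assms(5)] left unfolding last_max_def by metis
  qed
qed

section \<open>Vanishing of the string lengths\<close>

lemma eps_zero_diag: "1 \<le> i \<Longrightarrow> KR_eps n i m i A = 0 \<Longrightarrow> A i i = 0"
  unfolding KR_eps_def by simp

lemma eps_zero_right:
  assumes "1 \<le> i" "i < l" "KR_eps n i m l A = 0"
  shows "A i l = 0"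
  using KR_eps_right[OF assms(1,2), of n m A] assms(1,3)
    zig_le_peak[of i 1 i "\<lambda>j. A j (l - 1)" "\<lambda>j. A j l"]
    zig_right_end[of 1 i "\<lambda>j. A j (l - 1)" "\<lambda>j. A j l"]
  by (simp flip: of_nat_sum)

lemma eps_zero_left:
  assumes "i \<le> n" "1 \<le> l" "l < i" "KR_eps n i m l A = 0" "q \<in> {i..n}"
  shows "A l q \<le> (\<Sum>j\<in>{i..<q}. A (Suc l) j)"
proof -
  have "(\<Sum>j=i..q. int (A l j)) \<le> (\<Sum>j\<in>{i..<q}. int (A (Suc l) j))"
    using KR_eps_left[OF assms(1-3), of m A] assms(4) zig_minus_right[OF assms(5), of "A l" "A (Suc l)"]
      zig_le_peak[OF assms(5), of "A l" "A (Suc l)"] by simp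
  then have "(\<Sum>j=i..q. A l j) \<le> (\<Sum>j\<in>{i..<q}. A (Suc l) j)" by (simp flip: of_nat_sum)
  moreover have "A l q \<le> (\<Sum>j=i..q. A l j)" using assms(5) by (intro member_le_sum) auto
  ultimately show ?thesis by simp
qed

lemma phi_zero_right:
  assumes "1 \<le> i" "i < l" "KR_phi n i m l A = 0"
  shows "A 1 (l - 1) = 0"
  using KR_phi_right[OF assms(1,2), of n m A] assms(1,3)
    zig_le_peak[of 1 1 i "\<lambda>j. A j (l - 1)" "\<lambda>j. A j l"]
    zig_left_end[of 1 i "\<lambda>j. A j (l - 1)" "\<lambda>j. A j l"]
  by (simp flip: of_nat_sum)

lemma phi_zero_left:
  assumes "i \<le> n" "1 \<le> l" "l < i" "KR_phi n i m l A = 0" "\<And>q. A l q = 0" "q \<in> {i..n}"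
  shows "A (Suc l) q = 0"
proof -
  have "(\<Sum>j=q..n. int (A (Suc l) j)) \<le> 0"
    using KR_phi_left[OF assms(1-3), of m A] assms(4,5) zig_minus_left[OF assms(6), of "A l" "A (Suc l)"]
      zig_le_peak[OF assms(6), of "A l" "A (Suc l)"] by simp
  then have "(\<Sum>j=q..n. A (Suc l) j) = 0" by (simp flip: of_nat_sum)
  then show ?thesis using assms(6) by simp
qed

text \<open>
  The last column comes first: \<open>\<epsilon>\<^sub>q = 0\<close> forces its entry in row \<open>q\<close> to vanish for \<open>q \<noteq> k\<close>, and an entry
  of an earlier column \<open>p \<noteq> k\<close> is bounded by a sum over smaller row indices in column \<open>p + 1\<close>.
  Emptiness in the rows \<open>q < k\<close>, or of the columns \<open>p > k\<close>, therefore propagates from right to left.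
\<close>

lemma eps_zero_support:
  assumes i: "1 \<le> i" "i \<le> n" and A: "A \<in> KR_elems n i m"
    and eps: "\<And>l. 1 \<le> l \<Longrightarrow> l \<le> n \<Longrightarrow> l \<noteq> k \<Longrightarrow> KR_eps n i m l A = 0"
    and "A p q \<noteq> 0"
  shows "p \<in> {1..min i k} \<and> q \<in> {max i k..n}"
proof -
  have "\<forall>q. q < k \<or> k < p \<longrightarrow> A p q = 0" if "p \<le> i" for p
    using that
  proof (induction p rule: inc_induct)
    case base
    have "A i q = 0" if "q < k \<or> k < i" for q
    proof -
      consider "q \<notin> {i..n}" | "q = i" | "i < q" "q \<le> n" by fastforce
      then show ?thesis
      proof cases
        case 1
        then show ?thesis using KR_elems_supp[OF A, of i q] by auto
      next
        case 2
        then show ?thesis using eps_zero_diag[OF i(1) eps[of i]] i that by auto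
      next
        case 3
        then show ?thesis using eps_zero_right[OF i(1) 3(1) eps[of q]] i that by auto
      qed
    qed
    then show ?case by auto
  next
    case (step p)
    have "A p q = 0" if "q < k \<or> k < p" for q
    proof (cases "1 \<le> p \<and> q \<in> {i..n}")
      case True
      then have "KR_eps n i m p A = 0" using step(2) i that by (intro eps) auto
      then have "A p q \<le> (\<Sum>j\<in>{i..<q}. A (Suc p) j)"
        using True step(2) i by (intro eps_zero_left) auto
      also have "\<dots> = 0" using step.IH that by (intro sum.neutral) auto
      finally show ?thesis by simp
    next
      case False
      then show ?thesis using KR_elems_supp[OF A, of p q] by auto
    qed
    then show ?case by auto
  qed
  moreover have "p \<in> {1..i}" "q \<in> {i..n}" using KR_elems_nonzero[OF A \<open>A p q \<noteq> 0\<close>] by simp_all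
  ultimately have "\<not> (q < k \<or> k < p)" using \<open>A p q \<noteq> 0\<close> by (meson atLeastAtMost_iff)
  then show ?thesis using \<open>p \<in> {1..i}\<close> \<open>q \<in> {i..n}\<close> by auto
qed

text \<open>
  Here the first column comes first: \<open>\<phi>\<^sub>0 = 0\<close> and \<open>\<phi>\<^sub>l = 0\<close> for \<open>l > max i k\<close> empty it, and \<open>\<phi>\<^sub>p = 0\<close> turns
  an empty column \<open>p\<close> into an empty column \<open>p + 1\<close>.
\<close>

lemma phi_zero_imp_zero:
  assumes i: "1 \<le> i" "i \<le> n" and k: "1 \<le> k" "k \<le> n" and A: "A \<in> KR_elems n i m"
    and supp: "\<And>p q. A p q \<noteq> 0 \<Longrightarrow> p \<in> {1..min i k} \<and> q \<in> {max i k..n}"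
    and phi: "\<And>l. l \<le> n \<Longrightarrow> l < min i k \<or> max i k < l \<Longrightarrow> KR_phi n i m l A = 0"
  shows "A = zero_arr"
proof -
  have "\<forall>q. A p q = 0" if "1 \<le> p" "p \<le> min i k" for p
    using that
  proof (induction p rule: dec_induct)
    case base
    have "A 1 q = 0" for q
    proof -
      consider "q \<notin> {max i k..n}" | "q = n" | "max i k \<le> q" "q < n" by fastforce
      then show ?thesis
      proof cases
        case 1
        then show ?thesis using supp by blast
      next
        case 2
        then show ?thesis using phi[of 0] i k unfolding KR_phi_def by simp
      next
        case 3
        then show ?thesis using phi_zero_right[of i "Suc q" n m A] phi[of "Suc q"] i by simp
      qed
    qed
    then show ?case by simp
  next
    case (step p)
    have "A (Suc p) q = 0" for q
    proof (cases "q \<in> {i..n}")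
      case True
      then show ?thesis using step phi_zero_left[of i n p m A q] phi[of p] i by auto
    next
      case False
      then show ?thesis using KR_elems_supp[OF A] by auto
    qed
    then show ?case by simp
  qed
  then have "A p q = 0" for p q using supp[of p q] by (cases "A p q = 0") auto
  then show ?thesis unfolding zero_arr_def by auto
qed

section \<open>Energy of elements with a trivial second factor\<close>

lemma zero_arr_KR: "zero_arr \<in> KR_elems n i m"
  unfolding KR_elems_def zero_arr_def by simp

lemma KR_phi_zero_arr: "l \<noteq> i \<Longrightarrow> KR_phi n i m l zero_arr = 0"
  unfolding KR_phi_def zero_arr_def by simp

lemma KR_eps_zero_arr: "KR_eps n i m 0 zero_arr = int m"
  unfolding KR_eps_def zero_arr_def by simp

locale normalized_energy =
  fixes n r1 r2 s1 s2 :: nat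
    and \<sigma> :: "arr \<times> arr \<Rightarrow> arr \<times> arr"
    and H :: "arr \<times> arr \<Rightarrow> int"
  assumes r1: "1 \<le> r1" "r1 \<le> n" and r2: "1 \<le> r2" "r2 \<le> n"
    and s12: "s1 \<le> s2"
    and R: "combinatorial_R n (KR n r1 s1) (KR n r2 s2) \<sigma>"
    and energy: "local_energy n (KR n r1 s1) (KR n r2 s2) \<sigma> H"
    and normalized: "H (zero_arr, zero_arr) = 0"
begin

definition rect :: "arr \<Rightarrow> nat" where
  "rect A = (\<Sum>p=1..min r1 r2. \<Sum>q=max r1 r2..n. A p q)"

lemma rect_wsum: "rect A = wsum {1..min r1 r2} {max r1 r2..n} (\<lambda>_ _. 1) A"
  unfolding rect_def wsum_def by simp

text \<open>
  The rectangle has two sides over which a classical raising operator can move a unit out, or one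
  corner where it can delete a unit. For \<open>r1 < r2\<close> the lower side is crossed by \<open>e\<^sub>l\<close> with \<open>l = r2\<close>, for
  \<open>r2 < r1\<close> the right side is; for \<open>r1 = r2\<close> the same operator deletes at the corner \<open>(r1, r1)\<close>.
\<close>

lemma rect_e:
  assumes "1 \<le> l" "l \<le> n" "KR_e n r1 s1 l A = Some A'"
  shows "rect A = rect A' + (if l = r2 then 1 else 0)"
  using r1 assms
proof (cases rule: KR_e_cases)
  case diag
  then show ?thesis
    using wsum_decr[of "{1..min r1 r2}" "{max r1 r2..n}" A r1 r1 "\<lambda>_ _. 1"] r1
    unfolding rect_wsum by (cases l r2 rule: linorder_cases) (auto split: if_splits)
next
  case (right q)
  then show ?thesis
    using wsum_move[of "{1..min r1 r2}" "{max r1 r2..n}" A q l "\<lambda>_ _. 1" q "l - 1"] assms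
    unfolding rect_wsum by (cases l r2 rule: linorder_cases) (auto split: if_splits)
next
  case (left q)
  then show ?thesis
    using wsum_move[of "{1..min r1 r2}" "{max r1 r2..n}" A l q "\<lambda>_ _. 1" "Suc l" q] assms
    unfolding rect_wsum by (cases l r2 rule: linorder_cases) (auto split: if_splits)
qed

lemma H_raise_first:
  assumes "A \<in> KR_elems n r1 s1" "B \<in> KR_elems n r2 s2" "1 \<le> l" "l \<le> n"
    and "KR_phi n r2 s2 l B < KR_eps n r1 s1 l A" "KR_e n r1 s1 l A = Some A'"
  shows "H (A', B) = H (A, B)"
  using energy assms unfolding local_energy_def tensor_def KR_def by fastforce

lemma H_raise_second:
  assumes "A \<in> KR_elems n r1 s1" "B \<in> KR_elems n r2 s2" "1 \<le> l" "l \<le> n"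
    and "KR_eps n r1 s1 l A \<le> KR_phi n r2 s2 l B" "KR_e n r2 s2 l B = Some B'"
  shows "H (A, B') = H (A, B)"
  using energy assms unfolding local_energy_def tensor_def KR_def by fastforce

text \<open>
  Write \<open>\<sigma> (A \<otimes> 0) = b \<otimes> c\<close>. As \<open>\<epsilon>\<^sub>0\<close> of both sides is \<open>s2 + \<epsilon>\<^sub>0(A)\<close> with \<open>\<epsilon>\<^sub>0(A) > 0\<close>, which exceeds \<open>s1 \<ge> \<epsilon>\<^sub>0(c)\<close>, the
  maximum that defines \<open>\<epsilon>\<^sub>0(b \<otimes> c)\<close> is attained only by its second argument. So
  \<open>\<epsilon>\<^sub>0(b) > \<phi>\<^sub>0(c)\<close>, and \<open>e\<^sub>0\<close> acts on the first factor on both sides.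
\<close>

lemma H_affine_step:
  assumes A: "A \<in> KR_elems n r1 s1" and e: "KR_e n r1 s1 0 A = Some A'"
  shows "H (A', zero_arr) = H (A, zero_arr) - 1"
proof -
  let ?T = "tensor (KR n r1 s1) (KR n r2 s2)" and ?T' = "tensor (KR n r2 s2) (KR n r1 s1)"
  have pos: "0 < KR_eps n r1 s1 0 A"
  proof -
    have "0 \<le> KR_eps n r1 s1 0 A"
      using hook_path(1)[OF r1 A] r1 unfolding KR_eps_def by (simp flip: of_nat_sum)
    moreover have "KR_eps n r1 s1 0 A \<noteq> 0" using e unfolding KR_e_def by (auto split: if_splits)
    ultimately show ?thesis by simp
  qed
  have phi0: "KR_phi n r2 s2 0 zero_arr = 0" using r2 by (intro KR_phi_zero_arr) auto
  have mem: "(A, zero_arr) \<in> elems ?T" using A zero_arr_KR unfolding tensor_def KR_def by simp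
  obtain b c where bc: "\<sigma> (A, zero_arr) = (b, c)" by force
  have "eps ?T' 0 (b, c) = eps ?T 0 (A, zero_arr)"
    using R mem bc unfolding combinatorial_R_def crystal_iso_def by fastforce
  then have "max (KR_eps n r1 s1 0 c) (KR_eps n r2 s2 0 b + KR_eps n r1 s1 0 c - KR_phi n r1 s1 0 c)
      = int s2 + KR_eps n r1 s1 0 A"
    using pos unfolding tensor_def KR_def by (simp add: phi0 KR_eps_zero_arr)
  moreover have "KR_eps n r1 s1 0 c \<le> int s2"
    using s12 unfolding KR_eps_def by (simp flip: of_nat_sum)
  ultimately have "KR_phi n r1 s1 0 c < KR_eps n r2 s2 0 b" using pos by (auto simp: max_def split: if_splits)
  then have "etil_on_first (KR n r2 s2) (KR n r1 s1) 0 (\<sigma> (A, zero_arr))"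
    unfolding etil_on_first_def bc KR_def by simp
  moreover have "etil_on_first (KR n r1 s1) (KR n r2 s2) 0 (A, zero_arr)"
    using pos phi0 unfolding etil_on_first_def KR_def by simp
  moreover have "etil ?T 0 (A, zero_arr) = Some (A', zero_arr)"
    using pos phi0 e unfolding tensor_def KR_def by simp
  ultimately show ?thesis using energy mem unfolding local_energy_def by fastforce
qed

text \<open>
  The invariant of the connected components under the operators of index different from \<open>r2\<close>; the
  energy formula for a trivial second factor says that it is \<open>0\<close>.
\<close>

definition offset :: "arr \<Rightarrow> int" where
  "offset A = H (A, zero_arr) + int (rect A)"

lemma offset_e:
  assumes "A \<in> KR_elems n r1 s1" "l \<le> n" "l \<noteq> r2" "KR_e n r1 s1 l A = Some A'"
  shows "offset A' = offset A"
proof (cases "l = 0")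
  case True
  then have "A' = incr 1 n A" using assms unfolding KR_e_def by (auto split: if_splits)
  then have "rect A' = rect A + 1"
    using wsum_incr[of "{1..min r1 r2}" "{max r1 r2..n}" "\<lambda>_ _. 1" 1 n A] r1 r2
    unfolding rect_wsum by simp
  then show ?thesis using H_affine_step[OF assms(1)] assms True unfolding offset_def by simp
next
  case False
  then have l: "1 \<le> l" by simp
  have "KR_eps n r1 s1 l A \<noteq> 0" using assms unfolding KR_e_def by (auto split: if_splits)
  then have "0 < KR_eps n r1 s1 l A" using KR_eps_nonneg[OF r1 l, of s1 A] by simp
  then have "H (A', zero_arr) = H (A, zero_arr)"
    using assms l zero_arr_KR KR_phi_zero_arr[of l r2 n s2] by (intro H_raise_first) auto
  then show ?thesis using rect_e[OF l assms(2,4)] assms unfolding offset_def by simp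
qed

text \<open>
  Every lowering step moves a unit closer to the corner \<open>(1, n)\<close> or deletes it there; the weight
  \<open>p + (n - q)\<close> measures the number of steps that a unit at \<open>(p, q)\<close> still needs.
\<close>

lemma offset_supported:
  assumes "A \<in> KR_elems n r1 s1"
    and "\<And>p q. A p q \<noteq> 0 \<Longrightarrow> p \<in> {1..min r1 r2} \<and> q \<in> {max r1 r2..n}"
  shows "offset A = 0"
  using assms
proof (induction "wsum {1..r1} {r1..n} (\<lambda>p q. p + (n - q)) A" arbitrary: A rule: less_induct)
  case less
  show ?case
  proof (cases "\<forall>l. l \<le> n \<and> (l < min r1 r2 \<or> max r1 r2 < l) \<longrightarrow> KR_phi n r1 s1 l A = 0")
    case True
    then have "A = zero_arr"
      using phi_zero_imp_zero[OF r1 r2 less.prems(1,2)] by blast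
    then show ?thesis using normalized unfolding offset_def rect_def zero_arr_def by simp
  next
    case False
    then obtain l where l: "l \<le> n" "l < min r1 r2 \<or> max r1 r2 < l" "KR_phi n r1 s1 l A \<noteq> 0"
      by blast
    then have "l \<noteq> r1" "l \<noteq> r2" by auto
    obtain A' where f: "KR_f n r1 s1 l A = Some A'"
      using KR_f_defined l(3) by blast
    have A': "A' \<in> KR_elems n r1 s1" "KR_e n r1 s1 l A' = Some A"
      using KR_f_step[OF r1 l(1) \<open>l \<noteq> r1\<close> less.prems(1) f] by auto
    have "wsum {1..r1} {r1..n} (\<lambda>p q. p + (n - q)) A' < wsum {1..r1} {r1..n} (\<lambda>p q. p + (n - q)) A
        \<and> (\<forall>p q. A' p q \<noteq> 0 \<longrightarrow> p \<in> {1..min r1 r2} \<and> q \<in> {max r1 r2..n})"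
      using r1 l(1) \<open>l \<noteq> r1\<close> f
    proof (cases rule: KR_f_cases)
      case affine
      have "A p q \<noteq> 0" if "A' p q \<noteq> 0" for p q
        using that affine unfolding decr_def upd_def by (auto split: if_splits)
      then show ?thesis
        using wsum_decr[of "{1..r1}" "{r1..n}" A 1 n "\<lambda>p q. p + (n - q)"] affine r1 less.prems(2)
        by auto
    next
      case (right q)
      have "q \<in> {1..min r1 r2} \<and> l - 1 \<in> {max r1 r2..n}" using less.prems(2) right by blast
      then have "x \<in> {1..min r1 r2} \<and> y \<in> {max r1 r2..n}" if "A' x y \<noteq> 0" for x y
        using that right less.prems(2)[of x y] l by (auto simp: move_apply split: if_splits)
      then show ?thesis
        using wsum_move[of "{1..r1}" "{r1..n}" A q "l - 1" "\<lambda>p q. p + (n - q)" q l] right l(1)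
        by (cases l) auto
    next
      case (left q)
      have "Suc l \<in> {1..min r1 r2} \<and> q \<in> {max r1 r2..n}" using less.prems(2) left by blast
      then have "x \<in> {1..min r1 r2} \<and> y \<in> {max r1 r2..n}" if "A' x y \<noteq> 0" for x y
        using that left less.prems(2)[of x y] by (auto simp: move_apply split: if_splits)
      then show ?thesis
        using wsum_move[of "{1..r1}" "{r1..n}" A "Suc l" q "\<lambda>p q. p + (n - q)" l q] left
        by auto
    qed
    then have "offset A' = 0" using less.hyps[of A'] A'(1) by blast
    then show ?thesis using offset_e[OF A'(1) l(1) \<open>l \<noteq> r2\<close> A'(2)] by simp
  qed
qed

text \<open>
  The weight is the number of raising steps that a unit at \<open>(p, q)\<close> needs to reach \<open>(r1, r1)\<close> and
  disappear there, so that raising terminates.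
\<close>

lemma offset_zero:
  assumes "A \<in> KR_elems n r1 s1"
  shows "offset A = 0"
  using assms
proof (induction "wsum {1..r1} {r1..n} (\<lambda>p q. (r1 - p) + (q - r1) + 1) A" arbitrary: A
    rule: less_induct)
  case less
  let ?w = "\<lambda>p q. (r1 - p) + (q - r1) + 1"
  show ?case
  proof (cases "\<forall>l. 1 \<le> l \<and> l \<le> n \<and> l \<noteq> r2 \<longrightarrow> KR_eps n r1 s1 l A = 0")
    case True
    then show ?thesis
      using offset_supported[OF less.prems] eps_zero_support[OF r1 less.prems, of r2] by blast
  next
    case False
    then obtain l where l: "1 \<le> l" "l \<le> n" "l \<noteq> r2" "KR_eps n r1 s1 l A \<noteq> 0" by blast
    obtain A' where e: "KR_e n r1 s1 l A = Some A'"
      using KR_e_defined l(4) by blast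
    have "wsum {1..r1} {r1..n} ?w A' < wsum {1..r1} {r1..n} ?w A"
      using r1 l(1,2) e
    proof (cases rule: KR_e_cases)
      case diag
      then show ?thesis using wsum_decr[of "{1..r1}" "{r1..n}" A r1 r1 ?w] r1 by simp
    next
      case (right q)
      then show ?thesis using wsum_move[of "{1..r1}" "{r1..n}" A q l ?w q "l - 1"] l
        by (cases l) auto
    next
      case (left q)
      then show ?thesis using wsum_move[of "{1..r1}" "{r1..n}" A l q ?w "Suc l" q] l by auto
    qed
    moreover have "A' \<in> KR_elems n r1 s1" using KR_e_step[OF r1 l(1,2) less.prems e] by simp
    ultimately have "offset A' = 0" using less.hyps by blast
    then show ?thesis using offset_e[OF less.prems l(2,3) e] by simp
  qed
qed

end

section \<open>The raising procedure\<close>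

lemma etil_pow_KR:
  assumes i: "1 \<le> i" "i \<le> n" and l: "1 \<le> l" "l \<le> n" and A: "A \<in> KR_elems n i m"
    and k: "int k \<le> KR_eps n i m l A"
  defines "E \<equiv> \<lambda>k. etil_pow (KR n i m) l k A"
  shows "E 0 = A" and "E k \<in> KR_elems n i m" and "KR_eps n i m l (E k) = KR_eps n i m l A - int k"
    and "KR_phi n i m l (E k) = KR_phi n i m l A + int k"
    and "j < k \<Longrightarrow> KR_e n i m l (E j) = Some (E (Suc j))"
proof -
  show "E 0 = A" unfolding E_def etil_pow_def by simp
  let ?F = "\<lambda>k. ((\<lambda>x. Option.bind x (KR_e n i m l)) ^^ k) (Some A)"
  have E: "E k = the (?F k)" for k unfolding E_def etil_pow_def KR_def by simp
  have main: "?F k = Some (E k) \<and> E k \<in> KR_elems n i m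
      \<and> KR_eps n i m l (E k) = KR_eps n i m l A - int k
      \<and> KR_phi n i m l (E k) = KR_phi n i m l A + int k"
    if "int k \<le> KR_eps n i m l A" for k
    using that
  proof (induction k)
    case 0
    then show ?case using A by (simp add: E)
  next
    case (Suc k)
    then have IH: "?F k = Some (E k)" "E k \<in> KR_elems n i m"
       "KR_eps n i m l (E k) = KR_eps n i m l A - int k"
       "KR_phi n i m l (E k) = KR_phi n i m l A + int k" by auto
    then have "KR_eps n i m l (E k) \<noteq> 0" using Suc.prems by simp
    then obtain A' where A': "KR_e n i m l (E k) = Some A'" using KR_e_defined by blast
    then have F: "?F (Suc k) = Some A'" using IH(1) by simp
    then have "E (Suc k) = A'" unfolding E by simp
    then show ?case using F KR_e_step[OF i l IH(2) A'] IH(3,4) by simp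
  qed
  then show "E k \<in> KR_elems n i m" "KR_eps n i m l (E k) = KR_eps n i m l A - int k"
    "KR_phi n i m l (E k) = KR_phi n i m l A + int k" using k by auto
  show "KR_e n i m l (E j) = Some (E (Suc j))" if "j < k"
    using main[of j] main[of "Suc j"] that k by simp
qed

lemma etil_pow_invariant:
  assumes i: "1 \<le> i" "i \<le> n" and l: "1 \<le> l" "l \<le> n" and A: "A \<in> KR_elems n i m"
    and k: "int k \<le> KR_eps n i m l A"
    and "Q A" and step: "\<And>X X'. Q X \<Longrightarrow> KR_e n i m l X = Some X' \<Longrightarrow> Q X'"
  shows "Q (etil_pow (KR n i m) l k A)"
  using k
proof (induction k)
  case 0
  then show ?case using etil_pow_KR(1)[OF i l A, of 0] \<open>Q A\<close> by simp
next
  case (Suc k)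
  then show ?case using step etil_pow_KR(5)[OF i l A, of "Suc k" k] by auto
qed

context normalized_energy
begin

text \<open>
  The operators on the first factor are applied as long as \<open>\<epsilon>\<^sub>l(A) > \<phi>\<^sub>l(B)\<close>. After that
  \<open>\<epsilon>\<^sub>l(A) \<le> \<phi>\<^sub>l(B)\<close>, and this remains true while \<open>\<phi>\<^sub>l(B)\<close> grows, so that all further operators act on
  the second factor, as the tensor product rule demands.
\<close>

lemma raise_step_energy:
  assumes A: "A \<in> KR_elems n r1 s1" and B: "B \<in> KR_elems n r2 s2" and l: "1 \<le> l" "l \<le> n"
    and S: "raise_step (KR n r1 s1) (KR n r2 s2) l (A, B) = (A', B')"
  shows "A' \<in> KR_elems n r1 s1" "B' \<in> KR_elems n r2 s2" "H (A', B') = H (A, B)"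
    and "int (rect A) = int (rect A')
      + (if l = r2 then pos_part (KR_eps n r1 s1 l A - KR_phi n r2 s2 l B) else 0)"
proof -
  let ?a = "nat (KR_eps n r1 s1 l A - KR_phi n r2 s2 l B)" and ?b = "nat (KR_eps n r2 s2 l B)"
  let ?EA = "\<lambda>k. etil_pow (KR n r1 s1) l k A" and ?EB = "\<lambda>k. etil_pow (KR n r2 s2) l k B"
  have A': "A' = ?EA ?a" and B': "B' = ?EB ?b"
    using S unfolding raise_step_def KR_def by auto
  have phi: "0 \<le> KR_phi n r2 s2 l B" using KR_phi_nonneg[OF r2 l(1) B] .
  have a: "int ?a \<le> KR_eps n r1 s1 l A" using phi KR_eps_nonneg[OF r1 l(1), of s1 A] by simp
  have b: "int ?b \<le> KR_eps n r2 s2 l B" using KR_eps_nonneg[OF r2 l(1), of s2 B] by simp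
  show "A' \<in> KR_elems n r1 s1" unfolding A' using etil_pow_KR(2)[OF r1 l A a] .
  show "B' \<in> KR_elems n r2 s2" unfolding B' using etil_pow_KR(2)[OF r2 l B b] .
  have "H (?EA k, B) = H (A, B) \<and> rect A = rect (?EA k) + (if l = r2 then k else 0)"
    if "k \<le> ?a" for k
    using that
  proof (induction k)
    case 0
    then show ?case using etil_pow_KR(1)[OF r1 l A a] by simp
  next
    case (Suc k)
    then have "k \<le> ?a" by simp
    then have "int k \<le> int ?a" by (simp only: of_nat_le_iff)
    then have k: "int k \<le> KR_eps n r1 s1 l A" using a by (rule order_trans)
    have e: "KR_e n r1 s1 l (?EA k) = Some (?EA (Suc k))"
      using etil_pow_KR(5)[OF r1 l A a, of k] Suc.prems by simp
    have "KR_phi n r2 s2 l B < KR_eps n r1 s1 l (?EA k)"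
      using etil_pow_KR(3)[OF r1 l A k] Suc.prems by simp
    then have "H (?EA (Suc k), B) = H (?EA k, B)"
      using H_raise_first[OF etil_pow_KR(2)[OF r1 l A k] B l _ e] by simp
    moreover have "rect (?EA k) = rect (?EA (Suc k)) + (if l = r2 then 1 else 0)"
      using rect_e[OF l e] .
    ultimately show ?case using Suc by auto
  qed
  from this[of ?a] have HA: "H (A', B) = H (A, B)"
    and rA: "rect A = rect A' + (if l = r2 then ?a else 0)" unfolding A' by simp_all
  have le: "KR_eps n r1 s1 l A' \<le> KR_phi n r2 s2 l B"
    using etil_pow_KR(3)[OF r1 l A a] unfolding A' by simp
  have "H (A', ?EB k) = H (A', B)" if "k \<le> ?b" for k
    using that
  proof (induction k)
    case 0
    then show ?case using etil_pow_KR(1)[OF r2 l B b] by simp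
  next
    case (Suc k)
    then have "k \<le> ?b" by simp
    then have "int k \<le> int ?b" by (simp only: of_nat_le_iff)
    then have k: "int k \<le> KR_eps n r2 s2 l B" using b by (rule order_trans)
    have e: "KR_e n r2 s2 l (?EB k) = Some (?EB (Suc k))"
      using etil_pow_KR(5)[OF r2 l B b, of k] Suc.prems by simp
    have "KR_eps n r1 s1 l A' \<le> KR_phi n r2 s2 l (?EB k)"
      using etil_pow_KR(4)[OF r2 l B k] le by simp
    then have "H (A', ?EB (Suc k)) = H (A', ?EB k)"
      using H_raise_second[OF \<open>A' \<in> KR_elems n r1 s1\<close> etil_pow_KR(2)[OF r2 l B k] l _ e] by simp
    then show ?case using Suc by simp
  qed
  from this[of ?b] show "H (A', B') = H (A, B)" using HA unfolding B' by simp
  show "int (rect A) = int (rect A')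
      + (if l = r2 then pos_part (KR_eps n r1 s1 l A - KR_phi n r2 s2 l B) else 0)"
    using rA unfolding pos_part_def by auto
qed

end

text \<open>
  The state of the second factor after step \<open>r\<close> of stage \<open>s\<close>, in terms of the rows up to \<open>i + s\<close>. In
  the first part (\<open>r < i\<close>) only row \<open>i + s\<close> is occupied, and its first \<open>r\<close> columns are empty. In the
  second part everything that is left sits in column \<open>i\<close> and row \<open>t - 1\<close>, where \<open>t = 2 * i + s - r\<close> is
  the index of the last operator; after the last step this would be row \<open>i - 1\<close>, which lies outside
  the array.
\<close>

definition cleared :: "nat \<Rightarrow> nat \<Rightarrow> nat \<Rightarrow> arr \<Rightarrow> bool" where
  "cleared i s r B \<longleftrightarrow> (\<forall>p q. q \<le> i + s \<and> B p q \<noteq> 0 \<longrightarrow>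
     (if r < i then q = i + s \<and> r < p else p = i \<and> q + r + 1 = 2 * i + s))"

text \<open>
  An operator moves a unit only from a position that is occupied, so the positions known to be
  empty stay empty, apart from the target of the move; and once the operator is exhausted, \<open>\<epsilon>\<^sub>t = 0\<close>
  empties the next position.
\<close>

lemma cleared_step:
  assumes i: "1 \<le> i" "i \<le> n" and B: "B \<in> KR_elems n i m" and r: "r < i + s" "i + s \<le> n"
    and c: "cleared i s r B"
  defines "t \<equiv> raise_index i s (Suc r)"
  defines "B' \<equiv> etil_pow (KR n i m) t (nat (KR_eps n i m t B)) B"
  shows "cleared i s (Suc r) B'"
proof -
  have t: "1 \<le> t" "t \<le> n" using r i unfolding t_def raise_index_def by auto
  have k: "int (nat (KR_eps n i m t B)) \<le> KR_eps n i m t B"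
    using KR_eps_nonneg[OF i t(1), of m B] by simp
  have B': "B' \<in> KR_elems n i m" unfolding B'_def using etil_pow_KR(2)[OF i t B k] .
  have eps: "KR_eps n i m t B' = 0"
    unfolding B'_def using etil_pow_KR(3)[OF i t B k] KR_eps_nonneg[OF i t(1), of m B] by simp
  note inv = etil_pow_invariant[OF i t B k, folded B'_def]
  show ?thesis
  proof (cases "Suc r < i")
    case True
    then have tr: "t = Suc r" unfolding t_def raise_index_def by simp
    have "cleared i s r B'"
    proof (rule inv[of "cleared i s r", OF c])
      fix X X' assume X: "cleared i s r X" "KR_e n i m t X = Some X'"
      from i t X(2) show "cleared i s r X'"
      proof (cases rule: KR_e_cases)
        case (left q)
        have "q < i + s \<longrightarrow> X t q = 0" using X(1) True unfolding cleared_def by (metis less_imp_le_nat nat_neq_iff Suc_lessD)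
        then show ?thesis using X(1) left True tr unfolding cleared_def
          by (auto simp: move_apply split: if_splits)
      qed (use True tr in auto)
    qed
    then have old: "q \<le> i + s \<Longrightarrow> B' p q \<noteq> 0 \<Longrightarrow> q = i + s \<and> r < p" for p q
      using True unfolding cleared_def by auto
    have "B' t (i + s) \<le> (\<Sum>j\<in>{i..<i + s}. B' (Suc t) j)"
      using True tr r i eps by (intro eps_zero_left[of i n t m]) auto
    also have "\<dots> = 0"
    proof (intro sum.neutral ballI)
      fix j assume "j \<in> {i..<i + s}"
      then show "B' (Suc t) j = 0" using old[of j "Suc t"] by (cases "B' (Suc t) j = 0") auto
    qed
    finally have "B' t (i + s) = 0" by simp
    show ?thesis
      unfolding cleared_def
    proof (intro allI impI, elim conjE)
      fix p q assume pq: "q \<le> i + s" "B' p q \<noteq> 0"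
      then have "q = i + s" "r < p" using old by auto
      moreover from this have "p \<noteq> Suc r" using pq \<open>B' t (i + s) = 0\<close> tr by auto
      ultimately show "if Suc r < i then q = i + s \<and> Suc r < p
          else p = i \<and> q + Suc r + 1 = 2 * i + s" using True by simp
    qed
  next
    case False
    then have tr: "t + Suc r = 2 * i + s" "i \<le> t" "t \<le> i + s"
      using r unfolding t_def raise_index_def by auto
    \<comment> \<open>While \<open>e\<^sub>t\<close> acts, the remaining units are spread over the two rows \<open>t - 1\<close> and \<open>t\<close>.\<close>
    define Q where "Q X \<longleftrightarrow> (\<forall>p q. q \<le> i + s \<and> X p q \<noteq> 0 \<longrightarrow> p = i \<and> (q = t \<or> q + 1 = t))" for X :: arr
    have "Q B"
      unfolding Q_def
    proof (intro allI impI, elim conjE)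
      fix p q assume pq: "q \<le> i + s" "B p q \<noteq> 0"
      then have "p \<le> i" using KR_elems_nonzero[OF B, of p q] by simp
      then show "p = i \<and> (q = t \<or> q + 1 = t)"
        using c[unfolded cleared_def, rule_format, of q p] pq False tr by (auto split: if_splits)
    qed
    then have "Q B'"
    proof (rule inv[of Q])
      fix X X' assume X: "Q X" "KR_e n i m t X = Some X'"
      from i t X(2) show "Q X'"
      proof (cases rule: KR_e_cases)
        case diag
        then show ?thesis using X(1) unfolding Q_def decr_def upd_def by auto
      next
        case (right q)
        then have "q = i" using X(1) tr unfolding Q_def by blast
        then show ?thesis using X(1) right tr unfolding Q_def
          by (auto simp: move_apply split: if_splits)
      qed (use tr in auto)
    qed
    moreover have "B' i t = 0"
      using eps_zero_right[OF i(1) _ eps] eps_zero_diag[OF i(1), of n m B'] eps tr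
      by (cases "t = i") auto
    ultimately show ?thesis using False tr unfolding cleared_def Q_def by fastforce
  qed
qed

lemma cleared_next_row:
  assumes "B \<in> KR_elems n i m" "cleared i s (i + s) B" "1 \<le> i"
  shows "cleared i (Suc s) 0 B"
proof -
  have "B p q = 0" if "q \<le> i + s" for p q
  proof (rule ccontr)
    assume "B p q \<noteq> 0"
    then have "q + 1 = i" using assms(2) that unfolding cleared_def by fastforce
    then show False using KR_elems_nonzero[OF assms(1) \<open>B p q \<noteq> 0\<close>] by auto
  qed
  then show ?thesis using KR_elems_supp[OF assms(1), of 0] assms(3) unfolding cleared_def
    by (auto simp: le_Suc_eq intro: ccontr)
qed

context normalized_energy
begin

text \<open>
  The rectangle of the first factor loses units only in the last step of each stage, the only one
  with index \<open>r2\<close>; the number lost there is the term of the energy formula for this stage.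
\<close>

lemma raise_seq_invariant:
  assumes AB: "A \<in> KR_elems n r1 s1" "B \<in> KR_elems n r2 s2" and "r2 + s \<le> n" "r \<le> r2 + s"
  defines "X \<equiv> \<lambda>s r. fst (raise_seq (KR n r1 s1) (KR n r2 s2) r2 (A, B) s r)"
    and "Y \<equiv> \<lambda>s r. snd (raise_seq (KR n r1 s1) (KR n r2 s2) r2 (A, B) s r)"
  defines "gain \<equiv> \<lambda>s. pos_part (KR_eps n r1 s1 r2 (X s (r2 + s - 1)) - KR_phi n r2 s2 r2 (Y s (r2 + s - 1)))"
  shows "X s r \<in> KR_elems n r1 s1 \<and> Y s r \<in> KR_elems n r2 s2 \<and> H (X s r, Y s r) = H (A, B)
    \<and> cleared r2 s r (Y s r)
    \<and> int (rect A) = int (rect (X s r)) + (\<Sum>u<s. gain u) + (if r = r2 + s then gain s else 0)"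
    (is "?P s r")
proof -
  have step: "?P s (Suc r)" if P: "?P s r" and r: "r < r2 + s" "r2 + s \<le> n" for s r
  proof -
    define t where "t = raise_index r2 s (Suc r)"
    have t: "1 \<le> t" "t \<le> n" "t = r2 \<longleftrightarrow> Suc r = r2 + s"
      using r r2 unfolding t_def raise_index_def by auto
    have S: "raise_step (KR n r1 s1) (KR n r2 s2) t (X s r, Y s r) = (X s (Suc r), Y s (Suc r))"
      unfolding X_def Y_def t_def by simp
    then have Y: "Y s (Suc r) = etil_pow (KR n r2 s2) t (nat (KR_eps n r2 s2 t (Y s r))) (Y s r)"
      unfolding raise_step_def KR_def by simp
    note E = raise_step_energy[OF _ _ t(1,2) S]
    have "cleared r2 s (Suc r) (Y s (Suc r))"
      using cleared_step[OF r2 _ r, of "Y s r" s2] P unfolding Y t_def by simp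
    moreover have "int (rect (X s r)) = int (rect (X s (Suc r)))
        + (if Suc r = r2 + s then gain s else 0)"
    proof -
      have "r = r2 + s - 1" if "Suc r = r2 + s" using that by simp
      then show ?thesis using E(4) P t(3) unfolding gain_def by auto
    qed
    ultimately show ?thesis using P r E by simp
  qed
  have stage: "?P s r" if "?P s 0" "r2 + s \<le> n" "r \<le> r2 + s" for s r
    using that(3)
  proof (induction r)
    case 0
    show ?case by (rule that(1))
  next
    case (Suc r)
    show ?case using Suc.prems by (intro step[OF Suc.IH] that(2)) simp_all
  qed
  have "?P s 0" if "r2 + s \<le> n" for s
    using that
  proof (induction s)
    case 0
    have "cleared r2 0 0 B"
      unfolding cleared_def
    proof (intro allI impI, elim conjE)
      fix p q assume "q \<le> r2 + 0" "B p q \<noteq> 0"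
      moreover from this have "p \<in> {1..r2} \<and> q \<in> {r2..n}" by (intro KR_elems_nonzero[OF AB(2)])
      ultimately show "if 0 < r2 then q = r2 + 0 \<and> 0 < p else p = r2 \<and> q + 0 + 1 = 2 * r2 + 0"
        using r2 by auto
    qed
    then show ?case using AB r2 unfolding X_def Y_def by simp
  next
    case (Suc s)
    have IH: "?P s 0" by (rule Suc.IH) (use Suc.prems in simp)
    have P: "?P s (r2 + s)" by (rule stage[OF IH]) (use Suc.prems in simp_all)
    have XY: "X (Suc s) 0 = X s (r2 + s)" "Y (Suc s) 0 = Y s (r2 + s)"
      unfolding X_def Y_def by simp_all
    show ?case using P cleared_next_row[of "Y s (r2 + s)" n r2 s2 s] r2 unfolding XY by simp
  qed
  then show ?thesis using stage assms(3,4) by blast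
qed

end

section \<open>The energy formula\<close>

theorem theorem4p2:
  fixes n r1 r2 s1 s2 :: nat
    and A B :: arr
    and \<sigma> :: "arr \<times> arr \<Rightarrow> arr \<times> arr"
    and H :: "arr \<times> arr \<Rightarrow> int"
    and As Bs :: "nat \<Rightarrow> nat \<Rightarrow> arr"
  assumes "1 \<le> n"
    and "1 \<le> r1" "r1 \<le> n" "1 \<le> r2" "r2 \<le> n"
    and "1 \<le> s1" "s1 \<le> s2"
    and "combinatorial_R n (KR n r1 s1) (KR n r2 s2) \<sigma>"
    and "local_energy n (KR n r1 s1) (KR n r2 s2) \<sigma> H"
    and "H (zero_arr, zero_arr) = 0"
    and "(A, B) \<in> elems (tensor (KR n r1 s1) (KR n r2 s2))"
  defines "As \<equiv> \<lambda>s r. fst (raise_seq (KR n r1 s1) (KR n r2 s2) r2 (A, B) s r)"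
    and "Bs \<equiv> \<lambda>s r. snd (raise_seq (KR n r1 s1) (KR n r2 s2) r2 (A, B) s r)"
  shows "H (A, B) =
     - (\<Sum>p=1..min r1 r2. \<Sum>q=max r1 r2..n. int (A p q)) +
     (\<Sum>s=0..n - r2. pos_part (eps (KR n r1 s1) r2 (As s (r2 + s - 1))
                                - phi (KR n r2 s2) r2 (Bs s (r2 + s - 1))))"
proof -
  interpret normalized_energy n r1 r2 s1 s2 \<sigma> H
    using assms(2-10) by unfold_locales
  have AB: "A \<in> KR_elems n r1 s1" "B \<in> KR_elems n r2 s2"
    using assms(11) unfolding tensor_def KR_def by auto
  define S where "S = n - r2"
  have S: "r2 + S \<le> n" "r2 + S = n" using \<open>r2 \<le> n\<close> unfolding S_def by auto
  let ?gain = "\<lambda>s. pos_part (KR_eps n r1 s1 r2 (As s (r2 + s - 1))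
                                - KR_phi n r2 s2 r2 (Bs s (r2 + s - 1)))"
  have fin: "As S n \<in> KR_elems n r1 s1" "Bs S n \<in> KR_elems n r2 s2"
    "H (As S n, Bs S n) = H (A, B)" "cleared r2 S n (Bs S n)"
    "int (rect A) = int (rect (As S n)) + (\<Sum>u<S. ?gain u) + ?gain S"
    using raise_seq_invariant[OF AB S(1) order_refl] unfolding As_def Bs_def S(2) by simp_all
  have "Bs S n p q = 0" for p q
  proof (rule ccontr)
    assume nz: "Bs S n p q \<noteq> 0"
    then have "p \<in> {1..r2}" "q \<in> {r2..n}" using KR_elems_nonzero[OF fin(2) nz] by simp_all
    then show False using fin(4) nz S(2) unfolding cleared_def by fastforce
  qed
  then have "Bs S n = zero_arr" unfolding zero_arr_def by auto
  then have "H (A, B) = - int (rect (As S n))"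
    using offset_zero[OF fin(1)] fin(3) unfolding offset_def by simp
  also have "\<dots> = - int (rect A) + (\<Sum>s=0..S. ?gain s)"
    using fin(5) by (simp add: atLeast0AtMost lessThan_Suc_atMost[symmetric])
  finally show ?thesis unfolding rect_def S_def KR_def by simp
qed

end
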